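(* Let $\alpha,\beta>-1$ and write $x=\cos\theta$, $y=\cos\phi$, $0\le\theta,\phi\le\pi$. An orthonormal basis of $\mathcal{V}_{2n}(\mathcal{W}_{\alpha,\beta,-\frac12})$ is given, for $0\le k\le n$ and $0\le k\le n-1$ respectively, by $${}_1Q_{k,2n}(\cos\theta,\cos\phi)=\frac1{\sqrt2}\left[p_n^{(\alpha,\beta)}(\cos(\theta-\phi))p_k^{(\alpha,\beta)}(\cos(\theta+\phi))+p_k^{(\alpha,\beta)}(\cos(\theta-\phi))p_n^{(\alpha,\beta)}(\cos(\theta+\phi))\right],$$ $${}_2Q_{k,2n}(\cos\theta,\cos\phi)=\frac{b^{(1,1)}}{\sqrt2}(x^2-y^2)\left[p_{n-1}^{(\alpha+1,\beta+1)}(\cos(\theta-\phi))p_k^{(\alpha+1,\beta+1)}(\cos(\theta+\phi))+p_k^{(\alpha+1,\beta+1)}(\cos(\theta-\phi))p_{n-1}^{(\alpha+1,\beta+1)}(\cos(\theta+\phi))\right],$$ and an orthonormal basis of $\mathcal{V}_{2n+1}(\mathcal{W}_{\alpha,\beta,-\frac12})$ is given, for $0\le k\le n$, by $${}_1Q_{k,2n+1}(\cos\theta,\cos\phi)=\frac{b^{(0,1)}}{\sqrt2}(x+y)\left[p_n^{(\alpha,\beta+1)}(\cos(\theta-\phi))p_k^{(\alpha,\beta+1)}(\cos(\theta+\phi))+p_k^{(\alpha,\beta+1)}(\cos(\theta-\phi))p_n^{(\alpha,\beta+1)}(\cos(\theta+\phi))\right],$$ $${}_2Q_{k,2n+1}(\cos\theta,\cos\phi)=\frac{b^{(1,0)}}{\sqrt2}(x-y)\left[p_n^{(\alpha+1,\beta)}(\cos(\theta-\phi))p_k^{(\alpha+1,\beta)}(\cos(\theta+\phi))+p_k^{(\alpha+1,\beta)}(\cos(\theta-\phi))p_n^{(\alpha+1,\beta)}(\cos(\theta+\phi))\right],$$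 where, whenever the two Jacobi polynomials in a product have the same degree (i.e. $k=n$, respectively $k=n-1$ for ${}_2Q_{k,2n}$), the polynomial is to be multiplied by an additional factor $\frac1{\sqrt2}$.
   Context: $p_n^{(\alpha,\beta)}$ is the orthonormal Jacobi polynomial of degree $n$: $c_{\alpha,\beta}\int_{-1}^1p_n^{(\alpha,\beta)}p_m^{(\alpha,\beta)}(1-x)^\alpha(1+x)^\beta dx=\delta_{n,m}$, with positive leading coefficient, where $c_{\alpha,\beta}=\frac{\Gamma(\alpha+\beta+2)}{2^{\alpha+\beta+1}\Gamma(\alpha+1)\Gamma(\beta+1)}$. The weight function on $[-1,1]^2$ is $$\mathcal{W}_{\alpha,\beta,-\frac12}(x,y)=a_{\alpha,\beta,-\frac12}\,|x-y|^{2\alpha+1}|x+y|^{2\beta+1}(1-x^2)^{-\frac12}(1-y^2)^{-\frac12},$$ where for $\gamma>-1$, $\alpha+\gamma+\frac32>0$, $\beta+\gamma+\frac32>0$, $$a_{\alpha,\beta,\gamma}=\left(\int_{[-1,1]^2}(1-x)^\alpha(1+x)^\beta(1-y)^\alpha(1+y)^\beta|x-y|^{2\gamma+1}dxdy\right)^{-1}$$ (so $a_{\alpha,\beta,-\frac12}=c_{\alpha,\beta}^2$, and $\mathcal{W}_{\alpha,\beta,-\frac12}$ has integral $1$). Further $b^{(i,j)}=\sqrt{a_{\alpha+i,\beta+j,-\frac12}/a_{\alpha,\beta,-\frac12}}$. $\mathcal{V}_m(\mathcal{W})$ is the space of polynomials of total degree at most $m$ in two variables orthogonal, in $\langle f,g\rangle=\int_{[-1,1]^2}fg\,\mathcal{W}$,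 to all polynomials of total degree at most $m-1$; orthonormality is with respect to this inner product. *)

theory Defs
  imports "HOL-Analysis.Analysis" "HOL-Computational_Algebra.Polynomial"
begin

definition jacobi_c :: "real \<Rightarrow> real \<Rightarrow> real" where
  "jacobi_c \<alpha> \<beta> =
     Gamma (\<alpha> + \<beta> + 2) / (2 powr (\<alpha> + \<beta> + 1) * Gamma (\<alpha> + 1) * Gamma (\<beta> + 1))"

definition is_orthonormal_jacobi :: "real \<Rightarrow> real \<Rightarrow> (nat \<Rightarrow> real poly) \<Rightarrow> bool" where
  "is_orthonormal_jacobi \<alpha> \<beta> p \<longleftrightarrow>
     (\<forall>n. degree (p n) = n \<and> lead_coeff (p n) > 0) \<and>
     (\<forall>n m. jacobi_c \<alpha> \<beta> *
        (LINT x:{-1..1}|lborel.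
           poly (p n) x * poly (p m) x * (1 - x) powr \<alpha> * (1 + x) powr \<beta>) =
        (if n = m then 1 else 0))"

text \<open>For \<open>\<alpha>, \<beta> > -1\<close> the conditions determine the whole sequence uniquely.\<close>

definition jacobi_p :: "real \<Rightarrow> real \<Rightarrow> nat \<Rightarrow> real poly" where
  "jacobi_p \<alpha> \<beta> = (THE p. is_orthonormal_jacobi \<alpha> \<beta> p)"

definition sq2 :: "(real \<times> real) set" where
  "sq2 = {-1..1} \<times> {-1..1}"

text \<open>
  In the weights below \<open>0 powr t = 0\<close> for every \<open>t\<close>, so on the diagonals and on the boundary of
  the square the values may differ from the usual ones, but only on a null set.
\<close>

definition a_const :: "real \<Rightarrow> real \<Rightarrow> real \<Rightarrow> real" where
  "a_const \<alpha> \<beta> \<gamma> =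
     inverse (LINT (x, y):sq2|lborel.
       (1 - x) powr \<alpha> * (1 + x) powr \<beta> * (1 - y) powr \<alpha> * (1 + y) powr \<beta> *
       \<bar>x - y\<bar> powr (2 * \<gamma> + 1))"

definition W_weight :: "real \<Rightarrow> real \<Rightarrow> real \<times> real \<Rightarrow> real" where
  "W_weight \<alpha> \<beta> = (\<lambda>(x, y).
     a_const \<alpha> \<beta> (-1/2) * \<bar>x - y\<bar> powr (2 * \<alpha> + 1) * \<bar>x + y\<bar> powr (2 * \<beta> + 1) *
     (1 - x\<^sup>2) powr (-1/2) * (1 - y\<^sup>2) powr (-1/2))"

definition b_const :: "real \<Rightarrow> real \<Rightarrow> nat \<Rightarrow> nat \<Rightarrow> real" where
  "b_const \<alpha> \<beta> i j =
     sqrt (a_const (\<alpha> + real i) (\<beta> + real j) (-1/2) / a_const \<alpha> \<beta> (-1/2))"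

definition inner_w ::
    "(real \<times> real \<Rightarrow> real) \<Rightarrow> (real \<times> real \<Rightarrow> real) \<Rightarrow> (real \<times> real \<Rightarrow> real) \<Rightarrow> real" where
  "inner_w w f g = (LINT z:sq2|lborel. f z * g z * w z)"

text \<open>Real polynomials in two variables are identified with polynomial functions on the
  plane, so such a polynomial is determined by its values at \<open>(cos \<theta>, cos \<phi>)\<close>, i.e. on the square.\<close>

definition polys2 :: "nat \<Rightarrow> (real \<times> real \<Rightarrow> real) set" where
  "polys2 m = {f. \<exists>c :: nat \<Rightarrow> nat \<Rightarrow> real.
     f = (\<lambda>(x, y). \<Sum>i\<le>m. \<Sum>j\<le>m - i. c i j * x ^ i * y ^ j)}"

text \<open>
  Quantifying over all degree bounds \<open>j < m\<close> expresses orthogonality to the polynomials of degree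
  at most \<open>m - 1\<close> without truncated subtraction; for \<open>m = 0\<close> there is no condition.
\<close>

definition V_space :: "(real \<times> real \<Rightarrow> real) \<Rightarrow> nat \<Rightarrow> (real \<times> real \<Rightarrow> real) set" where
  "V_space w m = {f \<in> polys2 m. \<forall>j<m. \<forall>g\<in>polys2 j. inner_w w f g = 0}"

text \<open>Linear independence is not listed: it follows from orthonormality.\<close>

definition is_orthonormal_basis ::
    "(real \<times> real \<Rightarrow> real) \<Rightarrow> (real \<times> real \<Rightarrow> real) set \<Rightarrow> 'i set \<Rightarrow>
     ('i \<Rightarrow> real \<times> real \<Rightarrow> real) \<Rightarrow> bool" where
  "is_orthonormal_basis w V I Q \<longleftrightarrow>
     finite I \<and> (\<forall>i\<in>I. Q i \<in> V) \<and>
     (\<forall>i\<in>I. \<forall>j\<in>I. inner_w w (Q i) (Q j) = (if i = j then 1 else 0)) \<and>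
     (\<forall>f\<in>V. \<exists>c :: 'i \<Rightarrow> real. f = (\<lambda>z. \<Sum>i\<in>I. c i * Q i z))"

text \<open>The first factor is the extra normalization in the case of equal degrees.\<close>

definition jacobi_sym :: "real \<Rightarrow> real \<Rightarrow> nat \<Rightarrow> nat \<Rightarrow> real \<Rightarrow> real \<Rightarrow> real" where
  "jacobi_sym \<alpha> \<beta> m k \<theta> \<phi> =
     (if k = m then 1 / sqrt 2 else 1) *
     (poly (jacobi_p \<alpha> \<beta> m) (cos (\<theta> - \<phi>)) * poly (jacobi_p \<alpha> \<beta> k) (cos (\<theta> + \<phi>)) +
      poly (jacobi_p \<alpha> \<beta> k) (cos (\<theta> - \<phi>)) * poly (jacobi_p \<alpha> \<beta> m) (cos (\<theta> + \<phi>)))"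

end

theory Submission
  imports Defs "HOL-Library.Function_Algebras"
begin

text \<open>
  Put \<open>x = cos \<theta>\<close>, \<open>y = cos \<phi>\<close>, \<open>u = cos (\<theta> - \<phi>)\<close> and \<open>v = cos (\<theta> + \<phi>)\<close>. Then
  \<open>(1 - u) (1 - v) = (x - y)\<^sup>2\<close> and \<open>(1 + u) (1 + v) = (x + y)\<^sup>2\<close>, and up to a constant the Jacobian of
  \<open>(x, y) \<mapsto> (u, v)\<close> is \<open>\<bar>x\<^sup>2 - y\<^sup>2\<bar> / sqrt ((1 - x\<^sup>2) (1 - y\<^sup>2))\<close>. So the weight on the square is, up to
  normalization, the pullback of the measure \<open>w(u) w(v) du dv\<close>, where \<open>w\<close> is the Jacobi weight, and integrals of
  symmetric functions of \<open>(u, v)\<close> against it are double integrals against \<open>w(u) w(v)\<close>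
  (\<open>set_integral_rotated_weight\<close>). In the angles this change of variables is the linear map
  \<open>(\<theta>, \<phi>) \<mapsto> (\<theta> - \<phi>, \<theta> + \<phi>)\<close> acting on even periodic functions (\<open>nn_integral_rotate\<close>), so only
  one-dimensional shifts and dilations are needed.

  Since \<open>u + v = 2 x y\<close> and \<open>u v = x\<^sup>2 + y\<^sup>2 - 1\<close>, a symmetric polynomial in \<open>u\<close> and \<open>v\<close> is a polynomial in
  \<open>x\<close> and \<open>y\<close>, and \<open>p_n(u) p_k(v) + p_k(u) p_n(v)\<close> with \<open>k \<le> n\<close> has degree at most \<open>2 * n\<close>. Its inner products
  factor into those of the Jacobi polynomials. A prefactor \<open>(x - y)^i (x + y)^j\<close> with
  \<open>i, j \<in> {0, 1}\<close> enters inner products squared, which replaces \<open>\<alpha>\<close> and \<open>\<beta>\<close> in the weight by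
  \<open>\<alpha> + i\<close> and \<open>\<beta> + j\<close>, so orthonormality within each of the four families is the same
  computation. Functions from different families are orthogonal because they have different parity
  under \<open>(x, y) \<mapsto> (y, x)\<close> or \<open>(x, y) \<mapsto> (-x, -y)\<close> (\<open>inner_w_jacobi_Q\<close>).

  Completeness is a dimension count. In every degree \<open>d\<close> there are \<open>d + 1\<close> of these functions, as
  many as there are monomials of degree \<open>d\<close>, so all those of degree at most \<open>d\<close> together span the
  polynomials of degree at most \<open>d\<close> (\<open>jacobi_Q_spans\<close>).
\<close>

section \<open>Orthonormal polynomials for a positive functional\<close>

text \<open>
  Subtracting the right multiple of the last member kills the coefficient of degree \<open>n - 1\<close>, so
  induction on \<open>n\<close> applies. The disjunct \<open>r = 0\<close> is what survives for \<open>n = 0\<close>, because the zero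
  polynomial has degree 0.
\<close>

lemma poly_degree_lt_imp_combination:
  fixes q :: "nat \<Rightarrow> real poly"
  assumes deg: "\<And>i. i < n \<Longrightarrow> degree (q i) = i \<and> lead_coeff (q i) \<noteq> 0"
    and "r = 0 \<or> degree r < n"
  shows "\<exists>c. r = (\<Sum>i<n. smult (c i) (q i))"
  using assms
proof (induction n arbitrary: r)
  case 0
  then show ?case by simp
next
  case (Suc n)
  define a where "a = coeff r n / lead_coeff (q n)"
  define s where "s = r - smult a (q n)"
  have "coeff s k = 0" if "k \<ge> n" for k
  proof (cases "k = n")
    case True
    moreover have "lead_coeff (q n) \<noteq> 0" "degree (q n) = n" using Suc.prems(1)[of n] by blast+
    ultimately show ?thesis unfolding s_def a_def by (metis coeff_diff coeff_smult
        diff_self nonzero_eq_divide_eq)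
  next
    case False
    with that have "k > n" by simp
    with Suc.prems(1)[of n] have "coeff (q n) k = 0" by (simp add: coeff_eq_0)
    moreover have "coeff r k = 0"
      using Suc.prems(2) \<open>k > n\<close> by (auto intro: coeff_eq_0)
    ultimately show ?thesis by (simp add: s_def)
  qed
  then have "s = 0 \<or> degree s < n"
    using leading_coeff_neq_0 linorder_not_le by blast
  with Suc.IH[of s] Suc.prems(1) obtain c where c: "s = (\<Sum>i<n. smult (c i) (q i))"
    by (metis less_SucI)
  have "r = (\<Sum>i<Suc n. smult ((c(n := a)) i) (q i))"
    using c by (simp add: s_def algebra_simps)
  then show ?case by blast
qed

text \<open>
  Orthogonality of \<open>p\<close> and \<open>q\<close> is a property of the values of one linear functional at products
  \<open>p * q\<close>. Existence and uniqueness of the orthonormal sequence use nothing of the integral except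
  linearity and positivity on nonzero squares.
\<close>

locale positive_functional =
  fixes L :: "real poly \<Rightarrow> real"
  assumes L_add: "L (p + q) = L p + L q"
    and L_smult: "L (smult c p) = c * L p"
    and L_pos: "p \<noteq> 0 \<Longrightarrow> L (p * p) > 0"
begin

lemma L_zero: "L 0 = 0"
  using L_smult[of 0 0] by simp

lemma L_diff: "L (p - q) = L p - L q"
  using L_add[of p "smult (-1) q"] L_smult[of "-1" q] by simp

lemma L_sum: "L (\<Sum>i\<in>A. f i) = (\<Sum>i\<in>A. L (f i))"
  by (induction A rule: infinite_finite_induct) (simp_all add: L_zero L_add)

text \<open>
  Gram--Schmidt. Demanding orthogonality to \<^emph>\<open>all\<close> polynomials of lower degree, and not just to
  previously chosen ones, makes the claim for \<open>n\<close> independent of choices made below \<open>n\<close>: strong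
  induction suffices and no sequence has to be defined by recursion.
\<close>

lemma exists_monic_orthogonal:
  "\<exists>q. degree q = n \<and> lead_coeff q = 1 \<and> (\<forall>r. degree r < n \<longrightarrow> L (q * r) = 0)"
proof (induction n rule: less_induct)
  case (less n)
  then have "\<forall>i\<in>{..<n}. \<exists>q. degree q = i \<and> lead_coeff q = 1 \<and> (\<forall>r. degree r < i \<longrightarrow> L (q * r) = 0)"
    by blast
  from bchoice[OF this] obtain q where q: "\<And>i. i < n \<Longrightarrow> degree (q i) = i"
      "\<And>i. i < n \<Longrightarrow> lead_coeff (q i) = 1"
      "\<And>i r. i < n \<Longrightarrow> degree r < i \<Longrightarrow> L (q i * r) = 0"
    by (metis lessThan_iff)
  have orth: "L (q i * q j) = 0" if "i < n" "j < n" "i \<noteq> j" for i j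
  proof (cases "i < j")
    case True
    then show ?thesis using q(3)[of j "q i"] q(1)[of i] that by (simp add: mult.commute)
  next
    case False
    then show ?thesis using q(3)[of i "q j"] q(1)[of j] that by simp
  qed
  \<comment> \<open>Fourier coefficients of \<open>x ^ n\<close> with respect to the orthogonal family \<open>q\<close>\<close>
  define a where "a i = L (monom 1 n * q i) / L (q i * q i)" for i
  define s where "s = (\<Sum>i<n. smult (a i) (q i))"
  have ds: "coeff s k = 0" if "k \<ge> n" for k
    unfolding s_def coeff_sum using q(1) that
    by (intro sum.neutral) (auto simp: coeff_eq_0)
  define p where "p = monom 1 n - s"
  have cp: "coeff p n = 1" using ds[of n] by (simp add: p_def)
  have "degree p \<le> n"
    by (rule degree_le) (auto simp: p_def ds)
  with cp have dp: "degree p = n" using le_degree[of p n] by auto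
  have pq: "L (p * q j) = 0" if j: "j < n" for j
  proof -
    have "L (q j * q j) > 0" using L_pos[of "q j"] q(2)[OF j] by force
    have "L (s * q j) = (\<Sum>i<n. a i * L (q i * q j))"
      unfolding s_def sum_distrib_right L_sum by (simp add: L_smult)
    also have "\<dots> = (\<Sum>i<n. if i = j then a j * L (q j * q j) else 0)"
      using orth j by (intro sum.cong) auto
    also have "\<dots> = L (monom 1 n * q j)"
      using j \<open>L (q j * q j) > 0\<close> by (simp add: a_def)
    finally show ?thesis by (simp add: p_def left_diff_distrib L_diff)
  qed
  have "L (p * r) = 0" if "degree r < n" for r
  proof -
    have "degree (q i) = i \<and> lead_coeff (q i) \<noteq> 0" if "i < n" for i
      using q(1)[OF that] q(2)[OF that] by (metis zero_neq_one)
    from poly_degree_lt_imp_combination[of n q, OF this, of r] that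
    obtain c where "r = (\<Sum>i<n. smult (c i) (q i))" by blast
    then have "L (p * r) = (\<Sum>i<n. c i * L (p * q i))"
      by (simp add: sum_distrib_left L_sum L_smult)
    then show ?thesis using pq by simp
  qed
  then show ?case using dp cp by auto
qed

text \<open>
  For uniqueness, scale one candidate of degree \<open>n\<close> so that the leading coefficients agree. The
  difference of the two candidates has smaller degree, hence is orthogonal to both of them, hence
  to itself, hence zero. So the candidates are proportional; the factor is \<open>1\<close> since both have norm
  one and positive leading coefficient.
\<close>

theorem orthonormal_sequence_unique_existence:
  "\<exists>!p. (\<forall>n. degree (p n) = n \<and> lead_coeff (p n) > 0) \<and>
        (\<forall>n m. L (p n * p m) = (if n = m then 1 else 0))"
proof (rule ex_ex1I)
  obtain q where q: "\<And>n. degree (q n) = n" "\<And>n. lead_coeff (q n) = 1"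
      "\<And>n r. degree r < n \<Longrightarrow> L (q n * r) = 0"
    using exists_monic_orthogonal by metis
  have pos: "L (q n * q n) > 0" for n
    using L_pos[of "q n"] q(2)[of n] by force
  define p where "p n = smult (1 / sqrt (L (q n * q n))) (q n)" for n
  have "degree (p n) = n \<and> lead_coeff (p n) > 0" for n
    using q(1,2)[of n] pos[of n] by (simp add: p_def)
  moreover have "L (p n * p m) = (if n = m then 1 else 0)" for n m
  proof -
    have "L (q n * q m) = 0" if "n \<noteq> m"
      using q(1,3) that by (metis linorder_neqE_nat mult.commute)
    moreover have "sqrt (L (q n * q n)) * sqrt (L (q n * q n)) = L (q n * q n)" 
      using pos[of n] by simp
    ultimately show ?thesis
      using pos[of n] by (auto simp: p_def L_smult)
  qed
  ultimately show "\<exists>p. (\<forall>n. degree (p n) = n \<and> lead_coeff (p n) > 0) \<and>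
        (\<forall>n m. L (p n * p m) = (if n = m then 1 else 0))"
    by blast
next
  fix p p' :: "nat \<Rightarrow> real poly"
  assume P: "(\<forall>n. degree (p n) = n \<and> lead_coeff (p n) > 0) \<and>
        (\<forall>n m. L (p n * p m) = (if n = m then 1 else 0))"
    and P': "(\<forall>n. degree (p' n) = n \<and> lead_coeff (p' n) > 0) \<and>
        (\<forall>n m. L (p' n * p' m) = (if n = m then 1 else 0))"
  have p: "degree (p n) = n" "lead_coeff (p n) > 0"
      "L (p n * p m) = (if n = m then 1 else 0)" for n m
    using P by blast+
  have p': "degree (p' n) = n" "lead_coeff (p' n) > 0"
      "L (p' n * p' m) = (if n = m then 1 else 0)" for n m
    using P' by blast+
  have orth: "L (q n * r) = 0"
    if q: "\<And>n. degree (q n) = n" "\<And>n. lead_coeff (q n) > 0"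
      "\<And>n m. L (q n * q m) = (if n = m then 1 else 0)" and r: "r = 0 \<or> degree r < n" for q n r
  proof -
    have "degree (q i) = i \<and> lead_coeff (q i) \<noteq> 0" for i
      using q(1)[of i] q(2)[of i] by (metis less_irrefl)
    from poly_degree_lt_imp_combination[of n q, OF this r]
    obtain c where "r = (\<Sum>i<n. smult (c i) (q i))" by blast
    then have "L (q n * r) = (\<Sum>i<n. c i * L (q n * q i))"
      by (simp add: sum_distrib_left L_sum L_smult)
    then show ?thesis using q(3) by simp
  qed
  have "p n = p' n" for n
  proof -
    define t where "t = lead_coeff (p n) / lead_coeff (p' n)"
    have t: "t > 0" using p(2)[of n] p'(2)[of n] by (simp add: t_def)
    define r where "r = p n - smult t (p' n)"
    have "coeff r k = 0" if "k \<ge> n" for k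
    proof (cases "k = n")
      case True
      moreover have "t * lead_coeff (p' n) = lead_coeff (p n)"
        using p'(2)[of n] unfolding t_def by (metis less_irrefl nonzero_eq_divide_eq)
      ultimately show ?thesis using p(1)[of n] p'(1)[of n] by (simp add: r_def)
    next
      case False
      then show ?thesis using that p(1)[of n] p'(1)[of n] by (simp add: r_def coeff_eq_0)
    qed
    then have r: "r = 0 \<or> degree r < n"
      using leading_coeff_neq_0 linorder_not_le by blast
    have "L (r * r) = L (p n * r) - t * L (p' n * r)"
      by (simp add: r_def left_diff_distrib L_diff L_smult)
    also have "\<dots> = 0"
      using orth[of p, OF p r] orth[of p', OF p' r] by simp
    finally have "r = 0" using L_pos[of r] by fastforce
    then have eq: "p n = smult t (p' n)" by (simp add: r_def)
    have "1 = t * t"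
      using p(3)[of n n] p'(3)[of n n] by (simp add: eq L_smult)
    then have "t\<^sup>2 = 1" by (simp add: power2_eq_square)
    with t have "t = 1" by (simp add: power2_eq_1_iff)
    with eq show ?thesis by simp
  qed
  then show "p = p'" by blast
qed

end

section \<open>Rotation of even periodic functions\<close>

lemma nn_integral_shift:
  fixes f :: "real \<Rightarrow> ennreal"
  assumes [measurable]: "f \<in> borel_measurable borel"
  shows "(\<integral>\<^sup>+x. f (x + a) * indicator {c..<d} x \<partial>lborel) =
         (\<integral>\<^sup>+x. f x * indicator {c + a..<d + a} x \<partial>lborel)"
  by (subst (2) nn_integral_real_affine[of _ 1 a])
     (auto intro!: nn_integral_cong simp: add.commute split: split_indicator)

lemma nn_integral_split_Ico:
  fixes f :: "real \<Rightarrow> ennreal"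
  assumes [measurable]: "f \<in> borel_measurable borel" and "c \<le> d" "d \<le> e"
  shows "(\<integral>\<^sup>+x. f x * indicator {c..<e} x \<partial>lborel) =
         (\<integral>\<^sup>+x. f x * indicator {c..<d} x \<partial>lborel) + (\<integral>\<^sup>+x. f x * indicator {d..<e} x \<partial>lborel)"
  using assms(2,3)
  by (subst nn_integral_add[symmetric])
     (auto intro!: nn_integral_cong split: split_indicator)

text \<open>
  The part of the shifted interval that sticks out of \<open>{-pi..<pi}\<close> is a translate by one period of
  the part that is left uncovered. The bound on \<open>a\<close> ensures that one translation is enough.
\<close>

lemma nn_integral_period:
  fixes f :: "real \<Rightarrow> ennreal"
  assumes [measurable]: "f \<in> borel_measurable borel"
    and per: "\<And>x. f (x + 2 * pi) = f x" and a: "\<bar>a\<bar> \<le> 2 * pi"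
  shows "(\<integral>\<^sup>+x. f x * indicator {a - pi..<a + pi} x \<partial>lborel) =
         (\<integral>\<^sup>+x. f x * indicator {-pi..<pi} x \<partial>lborel)"
proof -
  have per': "(\<integral>\<^sup>+x. f x * indicator {c + 2 * pi..<d + 2 * pi} x \<partial>lborel) =
      (\<integral>\<^sup>+x. f x * indicator {c..<d} x \<partial>lborel)" for c d
    using nn_integral_shift[of f "2 * pi" c d] by (simp add: per)
  have pos: "(\<integral>\<^sup>+x. f x * indicator {b - pi..<b + pi} x \<partial>lborel) =
         (\<integral>\<^sup>+x. f x * indicator {-pi..<pi} x \<partial>lborel)" if b: "0 \<le> b" "b \<le> 2 * pi" for b
  proof -
    have "(\<integral>\<^sup>+x. f x * indicator {b - pi..<b + pi} x \<partial>lborel) =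
      (\<integral>\<^sup>+x. f x * indicator {b - pi..<pi} x \<partial>lborel) + (\<integral>\<^sup>+x. f x * indicator {pi..<b + pi} x \<partial>lborel)"
      using b by (intro nn_integral_split_Ico) auto
    also have "(\<integral>\<^sup>+x. f x * indicator {pi..<b + pi} x \<partial>lborel) =
        (\<integral>\<^sup>+x. f x * indicator {-pi..<b - pi} x \<partial>lborel)"
      using per'[of "-pi" "b - pi"] by (simp add: algebra_simps)
    also have "(\<integral>\<^sup>+x. f x * indicator {b - pi..<pi} x \<partial>lborel) + \<dots> =
       (\<integral>\<^sup>+x. f x * indicator {-pi..<pi} x \<partial>lborel)"
      using b nn_integral_split_Ico[of f "-pi" "b - pi" pi] by (simp add: add.commute)
    finally show ?thesis .
  qed
  show ?thesis
  proof (cases "a \<ge> 0")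
    case True
    with a pos show ?thesis by simp
  next
    case False
    have "(\<integral>\<^sup>+x. f x * indicator {a - pi..<a + pi} x \<partial>lborel) =
        (\<integral>\<^sup>+x. f x * indicator {(a + 2 * pi) - pi..<(a + 2 * pi) + pi} x \<partial>lborel)"
      using per'[of "a - pi" "a + pi"] by (simp add: algebra_simps)
    also have "\<dots> = (\<integral>\<^sup>+x. f x * indicator {-pi..<pi} x \<partial>lborel)"
      using a False by (intro pos) auto
    finally show ?thesis .
  qed
qed

text \<open>
  The map \<open>x \<mapsto> a + 2 * x\<close> runs through two periods with density \<open>1 / 2\<close>.
\<close>

lemma nn_integral_period_double:
  fixes f :: "real \<Rightarrow> ennreal"
  assumes [measurable]: "f \<in> borel_measurable borel"
    and per: "\<And>x. f (x + 2 * pi) = f x" and a: "\<bar>a\<bar> \<le> pi"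
  shows "(\<integral>\<^sup>+x. f (a + 2 * x) * indicator {-pi..<pi} x \<partial>lborel) =
         (\<integral>\<^sup>+x. f x * indicator {-pi..<pi} x \<partial>lborel)" (is "?L = ?R")
proof -
  have "(\<integral>\<^sup>+x. f x * indicator {a - 2 * pi..<a + 2 * pi} x \<partial>lborel) = 2 * ?L"
    by (subst nn_integral_real_affine[of _ 2 a])
       (auto intro!: arg_cong[where f="\<lambda>x. 2 * x"] nn_integral_cong split: split_indicator)
  moreover have "(\<integral>\<^sup>+x. f x * indicator {a - 2 * pi..<a + 2 * pi} x \<partial>lborel) =
     (\<integral>\<^sup>+x. f x * indicator {(a - pi) - pi..<(a - pi) + pi} x \<partial>lborel) +
     (\<integral>\<^sup>+x. f x * indicator {(a + pi) - pi..<(a + pi) + pi} x \<partial>lborel)"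
    using nn_integral_split_Ico[of f "a - 2 * pi" a "a + 2 * pi"] by (simp add: add.commute)
  moreover have "\<dots> = ?R + ?R"
    using a by (intro arg_cong2[where f="(+)"] nn_integral_period per) auto
  moreover have "?R + ?R = 2 * ?R" by (rule mult_2[symmetric])
  ultimately have "2 * ?L = 2 * ?R" by metis
  then show ?thesis by (simp add: ennreal_mult_cancel_left)
qed

lemma nn_integral_even:
  fixes f :: "real \<Rightarrow> ennreal"
  assumes [measurable]: "f \<in> borel_measurable borel" and even: "\<And>x. f (-x) = f x"
  shows "(\<integral>\<^sup>+x. f x * indicator {-pi..<pi} x \<partial>lborel) =
         2 * (\<integral>\<^sup>+x. f x * indicator {0..pi} x \<partial>lborel)"
proof -
  have closed: "(\<integral>\<^sup>+x. f x * indicator A x \<partial>lborel) = (\<integral>\<^sup>+x. f x * indicator {0..pi} x \<partial>lborel)"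
    if "{0<..<pi} \<subseteq> A" "A \<subseteq> {0..pi}" for A
  proof (rule nn_integral_cong_AE)
    show "AE x in lborel. f x * indicator A x = f x * indicator {0..pi} x"
      using AE_lborel_singleton[of "0::real"] AE_lborel_singleton[of pi]
    proof eventually_elim
      case (elim x)
      then have "x \<in> A \<longleftrightarrow> x \<in> {0..pi}"
        using that by (auto simp: less_eq_real_def subset_eq)
      then show ?case by (simp add: indicator_def)
    qed
  qed
  have "(\<integral>\<^sup>+x. f x * indicator {-pi..<0} x \<partial>lborel) = (\<integral>\<^sup>+x. f x * indicator {0<..pi} x \<partial>lborel)"
    by (subst nn_integral_real_affine[of _ "-1" 0])
       (auto intro!: nn_integral_cong simp: even split: split_indicator)
  moreover have ivl: "{0<..<pi} \<subseteq> {0<..pi}" "{0<..pi} \<subseteq> {0..pi}"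
      "{0<..<pi} \<subseteq> {0..<pi}" "{0..<pi} \<subseteq> {0..pi}"
    by auto
  ultimately show ?thesis
    using nn_integral_split_Ico[of f "-pi" 0 pi] 
      closed[of "{0<..pi}"]
      closed[of "{0..<pi}"]
    by (simp add: mult_2 ivl)
qed

lemma nn_integral_even2:
  fixes G :: "real \<Rightarrow> real \<Rightarrow> ennreal"
  assumes [measurable]: "case_prod G \<in> borel_measurable borel"
    and even: "\<And>x y. G (-x) y = G x y" "\<And>x y. G x (-y) = G x y"
  shows "(\<integral>\<^sup>+x. (\<integral>\<^sup>+y. G x y * indicator {-pi..<pi} y \<partial>lborel) * indicator {-pi..<pi} x \<partial>lborel) =
     4 * (\<integral>\<^sup>+x. (\<integral>\<^sup>+y. G x y * indicator {0..pi} y \<partial>lborel) * indicator {0..pi} x \<partial>lborel)"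
proof -
  have [measurable]: "case_prod G \<in> borel_measurable (borel \<Otimes>\<^sub>M borel)"
    using assms(1) by (simp add: borel_prod)
  have "(\<integral>\<^sup>+y. G x y * indicator {-pi..<pi} y \<partial>lborel) =
      2 * (\<integral>\<^sup>+y. G x y * indicator {0..pi} y \<partial>lborel)" for x
    by (rule nn_integral_even) (auto simp: even)
  then have "(\<integral>\<^sup>+x. (\<integral>\<^sup>+y. G x y * indicator {-pi..<pi} y \<partial>lborel) * indicator {-pi..<pi} x \<partial>lborel) =
    2 * (\<integral>\<^sup>+x. (\<integral>\<^sup>+y. G x y * indicator {0..pi} y \<partial>lborel) * indicator {-pi..<pi} x \<partial>lborel)"
    by (simp add: nn_integral_cmult[symmetric] mult_ac)
  also have "(\<integral>\<^sup>+x. (\<integral>\<^sup>+y. G x y * indicator {0..pi} y \<partial>lborel) * indicator {-pi..<pi} x \<partial>lborel) =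
     2 * (\<integral>\<^sup>+x. (\<integral>\<^sup>+y. G x y * indicator {0..pi} y \<partial>lborel) * indicator {0..pi} x \<partial>lborel)"
    by (rule nn_integral_even) (auto simp: even)
  finally show ?thesis by (simp add: mult.assoc[symmetric])
qed

text \<open>
  The rotation \<open>(x, y) \<mapsto> (x - y, x + y)\<close> does not preserve the square \<open>{0..pi} \<times> {0..pi}\<close>, but it
  is harmless on the torus. Evenness in each variable (for the rotated function this is where the
  symmetry of \<open>H\<close> enters) replaces the square by the full period square at the cost of a factor 4
  on both sides. There, shifting \<open>x\<close> by \<open>y\<close> turns \<open>H (x - y) (x + y)\<close> into \<open>H x (x + 2 * y)\<close>, and for
  fixed \<open>x\<close> the affine map \<open>y \<mapsto> x + 2 * y\<close> preserves the integral of a periodic function over a period.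
\<close>

lemma nn_integral_rotate:
  fixes H :: "real \<Rightarrow> real \<Rightarrow> ennreal"
  assumes H[measurable]: "case_prod H \<in> borel_measurable borel"
    and even: "\<And>x y. H (-x) y = H x y" and sym: "\<And>x y. H y x = H x y"
    and per: "\<And>x y. H (x + 2 * pi) y = H x y"
  shows "(\<integral>\<^sup>+x. (\<integral>\<^sup>+y. H (x - y) (x + y) * indicator {0..pi} y \<partial>lborel) * indicator {0..pi} x \<partial>lborel) =
    (\<integral>\<^sup>+x. (\<integral>\<^sup>+y. H x y * indicator {0..pi} y \<partial>lborel) * indicator {0..pi} x \<partial>lborel)"
proof -
  have H'[measurable]: "case_prod H \<in> borel_measurable (borel \<Otimes>\<^sub>M borel)"
    using assms(1) by (simp add: borel_prod)
  let ?J = "{-pi..<pi}"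
  have even': "H x (-y) = H x y" for x y using even[of y x] by (simp add: sym)
  have per': "H x (y + 2 * pi) = H x y" for x y using per[of y x] by (simp add: sym)
  have "(\<integral>\<^sup>+x. (\<integral>\<^sup>+y. H (x - y) (x + y) * indicator ?J y \<partial>lborel) * indicator ?J x \<partial>lborel) =
      (\<integral>\<^sup>+x. (\<integral>\<^sup>+y. H (x - y) (x + y) * indicator ?J y * indicator ?J x \<partial>lborel) \<partial>lborel)"
    by (simp add: nn_integral_multc)
  also have "\<dots> = (\<integral>\<^sup>+y. (\<integral>\<^sup>+x. H (x - y) (x + y) * indicator ?J y * indicator ?J x \<partial>lborel) \<partial>lborel)"
    by (rule lborel_pair.Fubini'[symmetric]) simp
  also have "\<dots> = (\<integral>\<^sup>+y. (\<integral>\<^sup>+x. H x (x + 2 * y) * indicator ?J y * indicator ?J x \<partial>lborel) \<partial>lborel)"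
  proof (rule nn_integral_cong)
    fix y :: real
    show "(\<integral>\<^sup>+x. H (x - y) (x + y) * indicator ?J y * indicator ?J x \<partial>lborel) =
      (\<integral>\<^sup>+x. H x (x + 2 * y) * indicator ?J y * indicator ?J x \<partial>lborel)"
    proof (cases "y \<in> ?J")
      case True
      define f where "f x = H (x - y) (x + y)" for x
      have [measurable]: "f \<in> borel_measurable borel" unfolding f_def by simp
      have "f (x + 2 * pi) = f x" for x
        using per[of "x - y" "x + y + 2 * pi"] per'[of "x - y" "x + y"] 
        by (simp add: f_def algebra_simps)
      then have "(\<integral>\<^sup>+x. f x * indicator {y - pi..<y + pi} x \<partial>lborel) = 
        (\<integral>\<^sup>+x. f x * indicator ?J x \<partial>lborel)"
        using True by (intro nn_integral_period) auto
      moreover have "(\<integral>\<^sup>+x. f (x + y) * indicator ?J x \<partial>lborel) =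
         (\<integral>\<^sup>+x. f x * indicator {-pi + y..<pi + y} x \<partial>lborel)"
        by (rule nn_integral_shift) simp
      ultimately show ?thesis using True
        by (simp add: f_def algebra_simps)
    qed simp
  qed
  also have "\<dots> = (\<integral>\<^sup>+x. (\<integral>\<^sup>+y. H x (x + 2 * y) * indicator ?J y * indicator ?J x \<partial>lborel) \<partial>lborel)"
    by (rule lborel_pair.Fubini') simp
  also have "\<dots> = (\<integral>\<^sup>+x. (\<integral>\<^sup>+y. H x (x + 2 * y) * indicator ?J y \<partial>lborel) * indicator ?J x \<partial>lborel)"
    by (simp add: nn_integral_multc)
  also have "\<dots> = (\<integral>\<^sup>+x. (\<integral>\<^sup>+y. H x y * indicator ?J y \<partial>lborel) * indicator ?J x \<partial>lborel)"
  proof (rule nn_integral_cong)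
    fix x :: real
    show "(\<integral>\<^sup>+y. H x (x + 2 * y) * indicator ?J y \<partial>lborel) * indicator ?J x =
      (\<integral>\<^sup>+y. H x y * indicator ?J y \<partial>lborel) * indicator ?J x"
      using nn_integral_period_double[of "H x" x] per' by (auto split: split_indicator)
  qed
  also have "\<dots> = 4 * (\<integral>\<^sup>+x. (\<integral>\<^sup>+y. H x y * indicator {0..pi} y \<partial>lborel) * indicator {0..pi} x \<partial>lborel)"
    by (rule nn_integral_even2) (auto simp: even even')
  also have "(\<integral>\<^sup>+x. (\<integral>\<^sup>+y. H (x - y) (x + y) * indicator ?J y \<partial>lborel) * indicator ?J x \<partial>lborel) =
    4 * (\<integral>\<^sup>+x. (\<integral>\<^sup>+y. H (x - y) (x + y) * indicator {0..pi} y \<partial>lborel) * indicator {0..pi} x \<partial>lborel)"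
  proof (rule nn_integral_even2)
    have "(\<lambda>p. H (fst p - snd p) (fst p + snd p)) \<in> borel_measurable (borel \<Otimes>\<^sub>M borel)"
      by simp
    then show "(\<lambda>(x, y). H (x - y) (x + y)) \<in> borel_measurable borel"
      by (simp add: borel_prod case_prod_beta')
    show "H (- x - y) (- x + y) = H (x - y) (x + y)" for x y
      using even[of "x + y" "x - y"] even'[of "-x - y" "x - y"] sym[of "x + y" "x - y"]
      by simp
    show "H (x - - y) (x + - y) = H (x - y) (x + y)" for x y
      by (simp add: sym)
  qed
  finally show ?thesis by (simp add: ennreal_mult_cancel_left)
qed

lemma nn_integral_cos_substitution:
  fixes f :: "real \<Rightarrow> ennreal"
  assumes [measurable]: "f \<in> borel_measurable borel"
  shows "(\<integral>\<^sup>+x. f x * indicator {-1..1} x \<partial>lborel) =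
         (\<integral>\<^sup>+t. f (cos t) * ennreal (sin t) * indicator {0..pi} t \<partial>lborel)"
proof -
  have "(\<integral>\<^sup>+x. f x * indicator {-1..1} x \<partial>lborel) =
        (\<integral>\<^sup>+x. f (-x) * indicator {-1..1} x \<partial>lborel)"
    by (subst nn_integral_real_affine[of _ "-1" 0])
       (auto intro!: nn_integral_cong split: split_indicator)
  also have "\<dots> = (\<integral>\<^sup>+x. f (-x) * indicator {- cos 0..- cos pi} x \<partial>lborel)"
    by simp
  also have "\<dots> = (\<integral>\<^sup>+t. f (- (- cos t)) * ennreal (sin t) * indicator {0..pi} t \<partial>lborel)"
    \<comment> \<open>the substitution rule wants an increasing function, hence \<open>- cos\<close>\<close>
  proof (rule nn_integral_substitution_aux[where f="\<lambda>x. f (-x)"])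
    show "((\<lambda>t. - cos t) has_real_derivative sin t) (at t)" for t
      by (auto intro!: derivative_eq_intros)
  qed (simp_all add: sin_ge_zero continuous_on_sin)
  finally show ?thesis by simp
qed

lemma nn_integral_square_cos_substitution:
  fixes F :: "real \<Rightarrow> real \<Rightarrow> ennreal"
  assumes [measurable]: "case_prod F \<in> borel_measurable borel"
  shows "(\<integral>\<^sup>+z. case_prod F z * indicator sq2 z \<partial>lborel) =
    (\<integral>\<^sup>+s. (\<integral>\<^sup>+t. F (cos s) (cos t) * ennreal (sin s * sin t) * indicator {0..pi} t \<partial>lborel)
        * indicator {0..pi} s \<partial>lborel)"
proof -
  have [measurable]: "case_prod F \<in> borel_measurable (borel \<Otimes>\<^sub>M borel)"
    using assms(1) by (simp add: borel_prod)
  have [measurable]: "sq2 \<in> sets (borel \<Otimes>\<^sub>M borel)"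
    by (simp add: sq2_def)
  have "(\<integral>\<^sup>+z. case_prod F z * indicator sq2 z \<partial>lborel) =
      (\<integral>\<^sup>+x. (\<integral>\<^sup>+y. F x y * indicator sq2 (x, y) \<partial>lborel) \<partial>lborel)"
    by (subst lborel_prod[symmetric], subst lborel.nn_integral_fst[symmetric]) simp_all
  also have "\<dots> = (\<integral>\<^sup>+x. (\<integral>\<^sup>+y. F x y * indicator {-1..1} y \<partial>lborel) * indicator {-1..1} x \<partial>lborel)"
  proof -
    have "F x y * indicator sq2 (x, y) = F x y * indicator {-1..1} y * indicator {-1..1} x" for x y
      by (auto simp: sq2_def split: split_indicator)
    then show ?thesis by (simp only:) (simp add: nn_integral_multc)
  qed
  also have "\<dots> = (\<integral>\<^sup>+x. (\<integral>\<^sup>+t. F x (cos t) * ennreal (sin t) * indicator {0..pi} t \<partial>lborel)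
       * indicator {-1..1} x \<partial>lborel)"
    by (simp add: nn_integral_cos_substitution)
  also have "\<dots> = (\<integral>\<^sup>+s. (\<integral>\<^sup>+t. F (cos s) (cos t) * ennreal (sin t) * indicator {0..pi} t \<partial>lborel)
       * ennreal (sin s) * indicator {0..pi} s \<partial>lborel)"
    by (rule nn_integral_cos_substitution) simp
  also have "\<dots> = (\<integral>\<^sup>+s. (\<integral>\<^sup>+t. F (cos s) (cos t) * ennreal (sin t) * indicator {0..pi} t * ennreal (sin s) \<partial>lborel)
       * indicator {0..pi} s \<partial>lborel)"
    by (simp add: nn_integral_multc)
  also have "\<dots> = (\<integral>\<^sup>+s. (\<integral>\<^sup>+t. F (cos s) (cos t) * ennreal (sin s * sin t) * indicator {0..pi} t \<partial>lborel)
        * indicator {0..pi} s \<partial>lborel)"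
  proof -
    have "F (cos s) (cos t) * ennreal (sin t) * indicator {0..pi} t * ennreal (sin s) =
        F (cos s) (cos t) * ennreal (sin s * sin t) * indicator {0..pi} t" if "s \<in> {0..pi}" for s t
      using that by (auto simp: ennreal_mult sin_ge_zero mult.assoc mult.commute[of "ennreal (sin t)"]
          split: split_indicator)
    then show ?thesis
      by (intro nn_integral_cong) (simp split: split_indicator)
  qed
  finally show ?thesis .
qed

section \<open>The Jacobi weight and its orthonormal polynomials\<close>

definition jacobi_weight :: "real \<Rightarrow> real \<Rightarrow> real \<Rightarrow> real" where
  "jacobi_weight \<alpha> \<beta> x = (1 - x) powr \<alpha> * (1 + x) powr \<beta>"

lemma jacobi_weight_nonneg: "jacobi_weight \<alpha> \<beta> x \<ge> 0"
  by (simp add: jacobi_weight_def)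

lemma jacobi_weight_measurable [measurable]: "jacobi_weight \<alpha> \<beta> \<in> borel_measurable borel"
  unfolding jacobi_weight_def by measurable

lemma jacobi_c_pos: "\<alpha> > -1 \<Longrightarrow> \<beta> > -1 \<Longrightarrow> jacobi_c \<alpha> \<beta> > 0"
  by (simp add: jacobi_c_def Gamma_real_pos)

text \<open>
  The substitution \<open>x = 2 * t - 1\<close> turns the integral into Euler's Beta integral.
\<close>

lemma has_bochner_integral_jacobi_weight:
  assumes "\<alpha> > -1" "\<beta> > -1"
  shows "has_bochner_integral lborel (\<lambda>x. indicator {-1..1} x * jacobi_weight \<alpha> \<beta> x)
           (1 / jacobi_c \<alpha> \<beta>)"
proof -
  have "set_integrable lborel {0..1} (\<lambda>t. t powr \<beta> * (1 - t) powr \<alpha>)"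
    using integrable_Beta[of "\<beta> + 1" "\<alpha> + 1"] assms by simp
  moreover have "(LINT t:{0..1}|lborel. t powr \<beta> * (1 - t) powr \<alpha>) = Beta (\<beta> + 1) (\<alpha> + 1)"
    using has_integral_Beta_real[of "\<beta> + 1" "\<alpha> + 1"] assms
      set_borel_integral_eq_integral(2)[OF calculation] integral_unique by simp
  ultimately have "has_bochner_integral lborel
      (\<lambda>t. indicator {0..1} t *\<^sub>R (t powr \<beta> * (1 - t) powr \<alpha>)) (Beta (\<beta> + 1) (\<alpha> + 1))"
    by (simp add: has_bochner_integral_iff set_integrable_def set_lebesgue_integral_def)
  from has_bochner_integral_mult_right[OF this, of "2 powr (\<alpha> + \<beta>)"]
  have "has_bochner_integral lborel
      (\<lambda>t. indicator {-1..1} (-1 + 2 * t) * jacobi_weight \<alpha> \<beta> (-1 + 2 * t))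
      (2 powr (\<alpha> + \<beta>) * Beta (\<beta> + 1) (\<alpha> + 1))"
  proof (rule has_bochner_integral_cong[THEN iffD1, rotated 3])
    fix t :: real
    have "(2 - 2 * t) powr \<alpha> * (2 * t) powr \<beta> = 2 powr (\<alpha> + \<beta>) * (t powr \<beta> * (1 - t) powr \<alpha>)"
      if "0 \<le> t" "t \<le> 1"
    proof -
      have "(2 - 2 * t) powr \<alpha> = 2 powr \<alpha> * (1 - t) powr \<alpha>"
        using powr_mult[of 2 "1 - t" \<alpha>] that by (simp add: algebra_simps)
      then show ?thesis using that by (simp add: powr_mult powr_add)
    qed
    then show "2 powr (\<alpha> + \<beta>) * (indicator {0..1} t *\<^sub>R (t powr \<beta> * (1 - t) powr \<alpha>)) =
        indicator {-1..1} (-1 + 2 * t) * jacobi_weight \<alpha> \<beta> (-1 + 2 * t)"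
      by (auto simp: jacobi_weight_def split: split_indicator)
  qed simp_all
  moreover have "2 powr (\<alpha> + \<beta>) * Beta (\<beta> + 1) (\<alpha> + 1) = (1 / jacobi_c \<alpha> \<beta>) / 2"
  proof -
    have "Gamma (\<alpha> + \<beta> + 2) > 0" using assms by (intro Gamma_real_pos) simp
    then show ?thesis
      by (simp add: jacobi_c_def Beta_def powr_add add_ac)
  qed
  ultimately show ?thesis
    by (subst lborel_has_bochner_integral_real_affine_iff[of 2 _ _ "-1"]) (simp_all add: mult.commute)
qed

lemma set_integrable_bounded_mult:
  fixes f w :: "'a \<Rightarrow> real"
  assumes w: "set_integrable M A w" and [measurable]: "f \<in> borel_measurable M"
    and bound: "\<And>x. x \<in> A \<Longrightarrow> \<bar>f x\<bar> \<le> B"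
  shows "set_integrable M A (\<lambda>x. f x * w x)"
proof -
  have w': "integrable M (\<lambda>x. B * (indicator A x * w x))"
    using w by (simp add: set_integrable_def)
  have [measurable]: "(\<lambda>x. indicator A x * w x) \<in> borel_measurable M"
    using w by (auto simp: set_integrable_def)
  have "integrable M (\<lambda>x. f x * (indicator A x * w x))"
    using w'
  proof (rule Bochner_Integration.integrable_bound)
    show "AE x in M. norm (f x * (indicator A x * w x)) \<le> norm (B * (indicator A x * w x))"
      using bound by (intro AE_I2) (fastforce simp: abs_mult split: split_indicator intro!: mult_right_mono)
  qed simp
  then show ?thesis by (simp add: set_integrable_def mult_ac)
qed

definition jacobi_functional :: "real \<Rightarrow> real \<Rightarrow> real poly \<Rightarrow> real" where
  "jacobi_functional \<alpha> \<beta> q =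
     jacobi_c \<alpha> \<beta> * (LINT x:{-1..1}|lborel. poly q x * jacobi_weight \<alpha> \<beta> x)"

lemma borel_measurable_poly [measurable]: "poly (q :: real poly) \<in> borel_measurable borel"
  by (intro borel_measurable_continuous_onI continuous_intros)

lemma set_integrable_poly_jacobi_weight:
  assumes "\<alpha> > -1" "\<beta> > -1"
  shows "set_integrable lborel {-1..1} (\<lambda>x. poly q x * jacobi_weight \<alpha> \<beta> x)"
proof -
  have "set_integrable lborel {-1..1} (jacobi_weight \<alpha> \<beta>)"
    using has_bochner_integral_jacobi_weight[OF assms]
    by (simp add: has_bochner_integral_iff set_integrable_def)
  moreover have "bounded (poly q ` {-1..1})"
    by (intro compact_imp_bounded compact_continuous_image continuous_intros) simp
  then obtain B where "\<forall>x\<in>{-1..1}. \<bar>poly q x\<bar> \<le> B"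
    unfolding bounded_iff by auto
  ultimately show ?thesis by (intro set_integrable_bounded_mult) auto
qed

lemma jacobi_functional_1: "\<alpha> > -1 \<Longrightarrow> \<beta> > -1 \<Longrightarrow> jacobi_functional \<alpha> \<beta> 1 = 1"
  using has_bochner_integral_jacobi_weight[of \<alpha> \<beta>] jacobi_c_pos[of \<alpha> \<beta>]
  by (simp add: jacobi_functional_def has_bochner_integral_iff set_lebesgue_integral_def)

text \<open>
  Positivity: the integrand \<open>p\<^sup>2 w\<close> is nonnegative and vanishes inside \<open>{-1<..<1}\<close> only at the
  finitely many roots of \<open>p\<close>, so it cannot vanish almost everywhere.
\<close>

lemma positive_functional_jacobi:
  assumes "\<alpha> > -1" "\<beta> > -1"
  shows "positive_functional (jacobi_functional \<alpha> \<beta>)"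
proof
  note int = set_integrable_poly_jacobi_weight[OF assms]
  show "jacobi_functional \<alpha> \<beta> (p + q) = jacobi_functional \<alpha> \<beta> p + jacobi_functional \<alpha> \<beta> q" for p q
    using set_integral_add(2)[OF int[of p] int[of q]]
    by (simp add: jacobi_functional_def algebra_simps)
  show "jacobi_functional \<alpha> \<beta> (smult c p) = c * jacobi_functional \<alpha> \<beta> p" for c p
    by (simp add: jacobi_functional_def mult.assoc)
  fix p :: "real poly" assume "p \<noteq> 0"
  let ?f = "\<lambda>x. indicator {-1..1} x * (poly (p * p) x * jacobi_weight \<alpha> \<beta> x)"
  have I: "integrable lborel ?f" using int[of "p * p"] by (simp add: set_integrable_def)
  have nonneg: "AE x in lborel. 0 \<le> ?f x"
    by (auto simp: jacobi_weight_nonneg split: split_indicator)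
  have "\<not> (AE x in lborel. ?f x = 0)"
  proof
    assume "AE x in lborel. ?f x = 0"
    moreover have "AE x in lborel. x \<notin> {x. poly p x = 0}"
      using poly_roots_finite[OF \<open>p \<noteq> 0\<close>] by (intro AE_not_in finite_imp_null_set_lborel)
    ultimately have "AE x::real in lborel. x \<notin> {-1<..<1}"
    proof eventually_elim
      case (elim x)
      then show ?case by (auto simp: jacobi_weight_def split: split_indicator_asm)
    qed
    then have "emeasure lborel {-1<..<1::real} = 0"
      by (subst (asm) AE_iff_measurable[of "{-1<..<1}"]) auto
    then show False by simp
  qed
  then have "integral\<^sup>L lborel ?f \<noteq> 0"
    using integral_nonneg_eq_0_iff_AE[OF I nonneg] by simp
  moreover have "integral\<^sup>L lborel ?f \<ge> 0"
    using nonneg by (rule integral_nonneg_AE)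
  ultimately show "jacobi_functional \<alpha> \<beta> (p * p) > 0"
    using jacobi_c_pos[OF assms] by (simp add: jacobi_functional_def set_lebesgue_integral_def)
qed

lemma is_orthonormal_jacobi_iff:
  "is_orthonormal_jacobi \<alpha> \<beta> p \<longleftrightarrow>
     (\<forall>n. degree (p n) = n \<and> lead_coeff (p n) > 0) \<and>
     (\<forall>n m. jacobi_functional \<alpha> \<beta> (p n * p m) = (if n = m then 1 else 0))"
  by (simp add: is_orthonormal_jacobi_def jacobi_functional_def jacobi_weight_def mult.assoc)

lemma is_orthonormal_jacobi_jacobi_p:
  assumes "\<alpha> > -1" "\<beta> > -1"
  shows "is_orthonormal_jacobi \<alpha> \<beta> (jacobi_p \<alpha> \<beta>)"
proof -
  interpret positive_functional "jacobi_functional \<alpha> \<beta>"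
    by (rule positive_functional_jacobi) fact+
  show ?thesis
    using orthonormal_sequence_unique_existence theI'[of "is_orthonormal_jacobi \<alpha> \<beta>"]
    unfolding jacobi_p_def is_orthonormal_jacobi_iff by blast
qed

lemma jacobi_p_properties:
  assumes "\<alpha> > -1" "\<beta> > -1"
  shows degree_jacobi_p: "degree (jacobi_p \<alpha> \<beta> n) = n"
    and jacobi_functional_jacobi_p:
      "jacobi_functional \<alpha> \<beta> (jacobi_p \<alpha> \<beta> n * jacobi_p \<alpha> \<beta> m) = (if n = m then 1 else 0)"
  using is_orthonormal_jacobi_jacobi_p[OF assms] by (auto simp: is_orthonormal_jacobi_iff)

lemma has_bochner_integral_lborel_product:
  fixes f g :: "real \<Rightarrow> real"
  assumes f: "integrable lborel f" and g: "integrable lborel g"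
  shows "has_bochner_integral lborel (\<lambda>(x, y). f x * g y) (integral\<^sup>L lborel f * integral\<^sup>L lborel g)"
proof -
  have [measurable]: "f \<in> borel_measurable borel" "g \<in> borel_measurable borel"
    using f g by auto
  have I: "integrable (lborel \<Otimes>\<^sub>M lborel) (\<lambda>(x, y). f x * g y)"
  proof (rule lborel_pair.Fubini_integrable)
    show "integrable lborel (\<lambda>x. \<integral>y. norm (case (x, y) of (x, y) \<Rightarrow> f x * g y) \<partial>lborel)"
      using f by (simp add: abs_mult)
    show "AE x in lborel. integrable lborel (\<lambda>y. case (x, y) of (x, y) \<Rightarrow> f x * g y)"
      using g by simp
  qed simp
  have "integral\<^sup>L (lborel \<Otimes>\<^sub>M lborel) (\<lambda>(x, y). f x * g y) =
      integral\<^sup>L lborel f * integral\<^sup>L lborel g"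
    using lborel_pair.integral_fst'[OF I] by simp
  with I show ?thesis by (simp add: has_bochner_integral_iff lborel_prod)
qed

lemma set_integral_poly_product:
  assumes "\<alpha> > -1" "\<beta> > -1"
  shows "set_integrable lborel sq2
      (\<lambda>(x, y). poly p x * poly q y * (jacobi_weight \<alpha> \<beta> x * jacobi_weight \<alpha> \<beta> y))" (is ?I)
    and "(jacobi_c \<alpha> \<beta>)\<^sup>2 * (LINT (x, y):sq2|lborel.
       poly p x * poly q y * (jacobi_weight \<alpha> \<beta> x * jacobi_weight \<alpha> \<beta> y)) =
       jacobi_functional \<alpha> \<beta> p * jacobi_functional \<alpha> \<beta> q" (is ?E)
proof -
  let ?f = "\<lambda>q x. indicator {-1..1} x * (poly q x * jacobi_weight \<alpha> \<beta> x)"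
  have "integrable lborel (?f q)" for q
    using set_integrable_poly_jacobi_weight[OF assms, of q] by (simp add: set_integrable_def)
  note * = has_bochner_integral_lborel_product[OF this this, of p q]
  have eq: "(\<lambda>(x, y). ?f p x * ?f q y) = (\<lambda>z. indicator sq2 z *\<^sub>R (case z of (x, y) \<Rightarrow>
     poly p x * poly q y * (jacobi_weight \<alpha> \<beta> x * jacobi_weight \<alpha> \<beta> y)))"
    by (auto simp: sq2_def fun_eq_iff indicator_times)
  show ?I using * unfolding eq set_integrable_def has_bochner_integral_iff by simp
  show ?E using * unfolding eq
    by (simp add: has_bochner_integral_iff set_lebesgue_integral_def jacobi_functional_def power2_eq_square)
qed

text \<open>
  For \<open>\<gamma> = -1/2\<close> the factor \<open>\<bar>x - y\<bar> powr (2 * \<gamma> + 1)\<close> is \<open>1\<close> off the diagonal but \<open>0 powr 0 = 0\<close> on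
  it; the diagonal therefore has to be seen to be a null set before that factor can be dropped.
\<close>

lemma AE_lborel_fst_neq_snd: "AE z in lborel :: (real \<times> real) measure. fst z \<noteq> snd z"
proof -
  have "AE z in lborel \<Otimes>\<^sub>M lborel :: (real \<times> real) measure. fst z \<noteq> snd z"
  proof (rule lborel_pair.AE_pair_measure)
    have "{z :: real \<times> real. fst z \<noteq> snd z} \<in> sets borel"
      by (intro borel_open open_Collect_neq continuous_intros)
    then show "{x \<in> space (lborel \<Otimes>\<^sub>M lborel). fst x \<noteq> (snd x :: real)} \<in> sets (lborel \<Otimes>\<^sub>M lborel)"
      unfolding lborel_prod by simp
    show "AE x in lborel. AE y in lborel. fst (x, y) \<noteq> (snd (x, y) :: real)"
    proof (rule AE_I2)
      fix x :: real
      show "AE y in lborel. fst (x, y) \<noteq> snd (x, y)"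
        using AE_lborel_singleton[of x] by eventually_elim auto
    qed
  qed
  then show ?thesis unfolding lborel_prod .
qed

lemma a_const_eq:
  assumes "\<alpha> > -1" "\<beta> > -1"
  shows "a_const \<alpha> \<beta> (-1/2) = (jacobi_c \<alpha> \<beta>)\<^sup>2"
proof -
  have "(LINT (x, y):sq2|lborel. (1 - x) powr \<alpha> * (1 + x) powr \<beta> * (1 - y) powr \<alpha> * (1 + y) powr \<beta> *
       \<bar>x - y\<bar> powr (2 * (-1/2) + 1)) =
     (LINT (x, y):sq2|lborel. poly 1 x * poly 1 y * (jacobi_weight \<alpha> \<beta> x * jacobi_weight \<alpha> \<beta> y))"
    unfolding set_lebesgue_integral_def
  proof (rule integral_cong_AE)
    show "AE z in lborel. indicator sq2 z *\<^sub>R (case z of (x, y) \<Rightarrow>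
       (1 - x) powr \<alpha> * (1 + x) powr \<beta> * (1 - y) powr \<alpha> * (1 + y) powr \<beta> * \<bar>x - y\<bar> powr (2 * (-1/2) + 1)) =
       indicator sq2 z *\<^sub>R (case z of (x, y) \<Rightarrow> poly 1 x * poly 1 y * (jacobi_weight \<alpha> \<beta> x * jacobi_weight \<alpha> \<beta> y))"
      using AE_lborel_fst_neq_snd
      by eventually_elim (auto simp: jacobi_weight_def)
  qed (simp_all add: lborel_prod[symmetric] sq2_def)
  moreover have "(LINT (x, y):sq2|lborel.
      poly 1 x * poly 1 y * (jacobi_weight \<alpha> \<beta> x * jacobi_weight \<alpha> \<beta> y)) * (jacobi_c \<alpha> \<beta>)\<^sup>2 = 1"
    by (subst mult.commute, subst set_integral_poly_product(2)[OF assms])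
       (simp add: jacobi_functional_1[OF assms])
  ultimately show ?thesis
    unfolding a_const_def by (simp only: inverse_unique)
qed

section \<open>The change of variables on the square\<close>

lemma sq2_borel [measurable]: "sq2 \<in> sets borel"
  by (simp add: sq2_def closed_Times borel_closed)

text \<open>
  The weight \<open>W_weight\<close> without its normalizing constant. The name refers to the
  rotation of the angles in \<open>u = cos (s - t)\<close>, \<open>v = cos (s + t)\<close>, where \<open>x = cos s\<close> and \<open>y = cos t\<close>: up
  to a constant and off the boundary it is the product weight \<open>w(u) w(v)\<close> times the Jacobian of \<open>(x, y) \<mapsto> (u, v)\<close>.
\<close>

definition rotated_weight :: "real \<Rightarrow> real \<Rightarrow> real \<times> real \<Rightarrow> real" where
  "rotated_weight \<alpha> \<beta> = (\<lambda>(x, y). \<bar>x - y\<bar> powr (2 * \<alpha> + 1) * \<bar>x + y\<bar> powr (2 * \<beta> + 1) *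
     (1 - x\<^sup>2) powr (-1/2) * (1 - y\<^sup>2) powr (-1/2))"

lemma W_weight_eq: "W_weight \<alpha> \<beta> z = a_const \<alpha> \<beta> (-1/2) * rotated_weight \<alpha> \<beta> z"
  by (simp add: W_weight_def rotated_weight_def case_prod_beta mult.assoc)

lemma rotated_weight_nonneg: "rotated_weight \<alpha> \<beta> z \<ge> 0"
  by (simp add: rotated_weight_def case_prod_beta)

lemma rotated_weight_measurable [measurable]: "rotated_weight \<alpha> \<beta> \<in> borel_measurable borel"
  unfolding rotated_weight_def borel_prod[symmetric] by measurable

text \<open>
  The product weight at \<open>(u, v)\<close> involves \<open>u\<close> and \<open>v\<close> only through \<open>(1 - u) (1 - v)\<close> and
  \<open>(1 + u) (1 + v)\<close>. That these are the squares of \<open>x - y\<close> and \<open>x + y\<close>, and that the Jacobian factor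
  \<open>sin (s - t) * sin (s + t)\<close> is minus the product of \<open>x - y\<close> and \<open>x + y\<close>, explains the form of
  \<open>W_weight\<close>.
\<close>

lemma one_minus_cos_mult:
  "(1 - cos (s - t)) * (1 - cos (s + t)) = (cos s - cos t)\<^sup>2" for s t :: real
proof -
  have "(1 - cos (s - t)) * (1 - cos (s + t)) =
      (1 - cos s * cos t)\<^sup>2 - (sin s)\<^sup>2 * (sin t)\<^sup>2"
    by (simp add: cos_add cos_diff algebra_simps power2_eq_square)
  also have "\<dots> = (1 - cos s * cos t)\<^sup>2 - (1 - (cos s)\<^sup>2) * (1 - (cos t)\<^sup>2)"
    by (simp add: sin_squared_eq)
  also have "\<dots> = (cos s - cos t)\<^sup>2" by (simp add: algebra_simps power2_eq_square)
  finally show ?thesis .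
qed

lemma one_plus_cos_mult:
  "(1 + cos (s - t)) * (1 + cos (s + t)) = (cos s + cos t)\<^sup>2" for s t :: real
proof -
  have "(1 + cos (s - t)) * (1 + cos (s + t)) =
      (1 + cos s * cos t)\<^sup>2 - (sin s)\<^sup>2 * (sin t)\<^sup>2"
    by (simp add: cos_add cos_diff algebra_simps power2_eq_square)
  also have "\<dots> = (1 + cos s * cos t)\<^sup>2 - (1 - (cos s)\<^sup>2) * (1 - (cos t)\<^sup>2)"
    by (simp add: sin_squared_eq)
  also have "\<dots> = (cos s + cos t)\<^sup>2" by (simp add: algebra_simps power2_eq_square)
  finally show ?thesis .
qed

lemma sin_diff_mult_sin_add:
  "sin (s - t) * sin (s + t) = - ((cos s - cos t) * (cos s + cos t))" for s t :: real
proof -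
  have "sin (s - t) * sin (s + t) = (sin s)\<^sup>2 * (cos t)\<^sup>2 - (cos s)\<^sup>2 * (sin t)\<^sup>2"
    by (simp add: sin_add sin_diff algebra_simps power2_eq_square)
  also have "\<dots> = (1 - (cos s)\<^sup>2) * (cos t)\<^sup>2 - (cos s)\<^sup>2 * (1 - (cos t)\<^sup>2)"
    by (simp add: sin_squared_eq)
  also have "\<dots> = - ((cos s - cos t) * (cos s + cos t))"
    by (simp add: algebra_simps power2_eq_square)
  finally show ?thesis .
qed

lemma powr_power2_abs: "(x\<^sup>2) powr a = \<bar>x\<bar> powr (2 * a)" for x :: real
proof -
  have "x\<^sup>2 = \<bar>x\<bar> powr 2" by simp
  then show ?thesis by (simp only: powr_powr)
qed

text \<open>
  The exponents \<open>2 * \<alpha> + 1\<close> and \<open>2 * \<beta> + 1\<close> split as \<open>2 * \<alpha>\<close> and \<open>2 * \<beta>\<close>, which come from the Jacobi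
  weights of \<open>u\<close> and \<open>v\<close>, plus one factor \<open>\<bar>x - y\<bar> * \<bar>x + y\<bar>\<close>, which is the Jacobian. On the boundary
  of the square the identity can fail because \<open>0 powr (-1/2) = 0\<close>, so the endpoints are excluded.
\<close>

lemma rotated_weight_cos:
  assumes "0 < s" "s < pi" "0 < t" "t < pi"
  shows "rotated_weight \<alpha> \<beta> (cos s, cos t) * (sin s * sin t) =
    jacobi_weight \<alpha> \<beta> (cos (s - t)) * jacobi_weight \<alpha> \<beta> (cos (s + t)) * \<bar>sin (s - t) * sin (s + t)\<bar>"
proof -
  have inv: "(1 - (cos r)\<^sup>2) powr (-1/2) * sin r = 1" if "0 < r" "r < pi" for r
  proof -
    have "sin r > 0" using that by (rule sin_gt_zero)
    then show ?thesis
      by (simp add: sin_squared_eq[symmetric] powr_power2_abs powr_minus)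
  qed
  have nonneg: "1 - cos r \<ge> 0" "1 + cos r \<ge> 0" for r :: real
    using cos_le_one[of r] cos_ge_minus_one[of r] by linarith+
  have "jacobi_weight \<alpha> \<beta> (cos (s - t)) * jacobi_weight \<alpha> \<beta> (cos (s + t)) =
      ((1 - cos (s - t)) * (1 - cos (s + t))) powr \<alpha> * ((1 + cos (s - t)) * (1 + cos (s + t))) powr \<beta>"
    using nonneg by (simp add: jacobi_weight_def powr_mult)
  also have "\<dots> = \<bar>cos s - cos t\<bar> powr (2 * \<alpha>) * \<bar>cos s + cos t\<bar> powr (2 * \<beta>)"
    by (simp add: one_minus_cos_mult one_plus_cos_mult powr_power2_abs)
  finally have "jacobi_weight \<alpha> \<beta> (cos (s - t)) * jacobi_weight \<alpha> \<beta> (cos (s + t)) * \<bar>sin (s - t) * sin (s + t)\<bar>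
     = \<bar>cos s - cos t\<bar> powr (2 * \<alpha> + 1) * \<bar>cos s + cos t\<bar> powr (2 * \<beta> + 1)"
    by (simp add: sin_diff_mult_sin_add abs_mult powr_add)
  moreover have "rotated_weight \<alpha> \<beta> (cos s, cos t) * (sin s * sin t) =
    \<bar>cos s - cos t\<bar> powr (2 * \<alpha> + 1) * \<bar>cos s + cos t\<bar> powr (2 * \<beta> + 1) *
    ((1 - (cos s)\<^sup>2) powr (-1/2) * sin s) * ((1 - (cos t)\<^sup>2) powr (-1/2) * sin t)"
    by (simp add: rotated_weight_def)
  ultimately show ?thesis using assms by (simp only: inv mult_1_right)
qed

lemma AE_Icc_imp_Ioo: "AE t::real in lborel. t \<in> {0..pi} \<longrightarrow> t \<in> {0<..<pi}"
  using AE_lborel_singleton[of "0::real"] AE_lborel_singleton[of pi]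
  by eventually_elim auto

text \<open>
  In the angles \<open>s\<close> and \<open>t\<close> both sides become integrals over \<open>{0..pi} \<times> {0..pi}\<close>: of
  \<open>H (s - t) (s + t)\<close> on the left and of \<open>H s t\<close> on the right, for the same function \<open>H\<close>. It is
  even, periodic and symmetric, so \<open>nn_integral_rotate\<close> identifies the two. Working
  with nonnegative functions avoids all questions of integrability at this stage.
\<close>

lemma nn_integral_rotated_weight:
  fixes F :: "real \<Rightarrow> real \<Rightarrow> ennreal" and f :: "real \<times> real \<Rightarrow> ennreal"
  assumes [measurable]: "case_prod F \<in> borel_measurable borel" "f \<in> borel_measurable borel"
    and sym: "\<And>u v. F v u = F u v"
    and f: "\<And>s t. s \<in> {0..pi} \<Longrightarrow> t \<in> {0..pi} \<Longrightarrow> f (cos s, cos t) = F (cos (s - t)) (cos (s + t))"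
  shows "(\<integral>\<^sup>+z. f z * ennreal (rotated_weight \<alpha> \<beta> z) * indicator sq2 z \<partial>lborel) =
    (\<integral>\<^sup>+(u, v). F u v * ennreal (jacobi_weight \<alpha> \<beta> u * jacobi_weight \<alpha> \<beta> v) * indicator sq2 (u, v) \<partial>lborel)"
proof -
  have M[measurable]: "case_prod F \<in> borel_measurable (borel \<Otimes>\<^sub>M borel)"
      "f \<in> borel_measurable (borel \<Otimes>\<^sub>M borel)"
      "rotated_weight \<alpha> \<beta> \<in> borel_measurable (borel \<Otimes>\<^sub>M borel)"
    using assms(1,2) rotated_weight_measurable by (simp_all add: borel_prod)
  define w where "w = jacobi_weight \<alpha> \<beta>"
  have [measurable]: "w \<in> borel_measurable borel" unfolding w_def by measurable
  have w0: "w x \<ge> 0" for x by (simp add: w_def jacobi_weight_nonneg)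
  define H where "H s t = F (cos s) (cos t) * ennreal (w (cos s) * w (cos t) * \<bar>sin s * sin t\<bar>)" for s t
  have H_meas: "case_prod H \<in> borel_measurable (borel \<Otimes>\<^sub>M borel)"
    unfolding H_def by measurable
  have "(\<integral>\<^sup>+z. f z * ennreal (rotated_weight \<alpha> \<beta> z) * indicator sq2 z \<partial>lborel) =
     (\<integral>\<^sup>+z. (case z of (x, y) \<Rightarrow> f (x, y) * ennreal (rotated_weight \<alpha> \<beta> (x, y))) * indicator sq2 z \<partial>lborel)"
    by (simp add: case_prod_beta)
  also have "\<dots> = (\<integral>\<^sup>+s. (\<integral>\<^sup>+t. f (cos s, cos t) * ennreal (rotated_weight \<alpha> \<beta> (cos s, cos t)) *
       ennreal (sin s * sin t) * indicator {0..pi} t \<partial>lborel) * indicator {0..pi} s \<partial>lborel)"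
    by (rule nn_integral_square_cos_substitution) (simp add: borel_prod[symmetric])
  also have "\<dots> = (\<integral>\<^sup>+s. (\<integral>\<^sup>+t. H (s - t) (s + t) * indicator {0..pi} t \<partial>lborel) * indicator {0..pi} s \<partial>lborel)"
  proof (rule nn_integral_cong_AE)
    have inner: "(\<integral>\<^sup>+t. f (cos s, cos t) * ennreal (rotated_weight \<alpha> \<beta> (cos s, cos t)) *
       ennreal (sin s * sin t) * indicator {0..pi} t \<partial>lborel) =
       (\<integral>\<^sup>+t. H (s - t) (s + t) * indicator {0..pi} t \<partial>lborel)" if s: "s \<in> {0<..<pi}" for s
    proof (rule nn_integral_cong_AE)
      have eq: "f (cos s, cos t) * ennreal (rotated_weight \<alpha> \<beta> (cos s, cos t)) *
         ennreal (sin s * sin t) = H (s - t) (s + t)" if t: "t \<in> {0<..<pi}" for t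
      proof -
        have "ennreal (rotated_weight \<alpha> \<beta> (cos s, cos t)) * ennreal (sin s * sin t) =
          ennreal (w (cos (s - t)) * w (cos (s + t)) * \<bar>sin (s - t) * sin (s + t)\<bar>)"
          using s t by (subst ennreal_mult'[symmetric])
            (simp_all add: rotated_weight_nonneg rotated_weight_cos w_def)
        then show ?thesis using s t f[of s t] by (simp add: H_def mult.assoc)
      qed
      show "AE t in lborel. f (cos s, cos t) * ennreal (rotated_weight \<alpha> \<beta> (cos s, cos t)) *
         ennreal (sin s * sin t) * indicator {0..pi} t = H (s - t) (s + t) * indicator {0..pi} t"
        using AE_Icc_imp_Ioo
      proof eventually_elim
        case (elim t)
        then show ?case using eq[of t] by (cases "t \<in> {0..pi}") simp_all
      qed
    qed
    show "AE s in lborel. (\<integral>\<^sup>+t. f (cos s, cos t) * ennreal (rotated_weight \<alpha> \<beta> (cos s, cos t)) *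
       ennreal (sin s * sin t) * indicator {0..pi} t \<partial>lborel) * indicator {0..pi} s =
       (\<integral>\<^sup>+t. H (s - t) (s + t) * indicator {0..pi} t \<partial>lborel) * indicator {0..pi} s"
      using AE_Icc_imp_Ioo
    proof eventually_elim
      case (elim s)
      then show ?case using inner[of s] by (cases "s \<in> {0..pi}") simp_all
    qed
  qed
  also have "\<dots> = (\<integral>\<^sup>+s. (\<integral>\<^sup>+t. H s t * indicator {0..pi} t \<partial>lborel) * indicator {0..pi} s \<partial>lborel)"
  proof (rule nn_integral_rotate)
    show "case_prod H \<in> borel_measurable borel" using H_meas by (simp add: borel_prod)
    show "H (- x) y = H x y" "H (x + 2 * pi) y = H x y" for x y by (simp_all add: H_def)
    show "H y x = H x y" for x y using sym[of "cos x" "cos y"] by (simp add: H_def mult_ac)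
  qed
  also have "\<dots> = (\<integral>\<^sup>+s. (\<integral>\<^sup>+t. F (cos s) (cos t) * ennreal (w (cos s) * w (cos t)) * ennreal (sin s * sin t)
      * indicator {0..pi} t \<partial>lborel) * indicator {0..pi} s \<partial>lborel)"
  proof -
    have "H s t = F (cos s) (cos t) * ennreal (w (cos s) * w (cos t)) * ennreal (sin s * sin t)"
      if "s \<in> {0..pi}" "t \<in> {0..pi}" for s t
      using that by (simp add: H_def mult.assoc[of "F _ _"] ennreal_mult'[symmetric] w0 sin_ge_zero abs_mult)
    then have "(\<integral>\<^sup>+t. H s t * indicator {0..pi} t \<partial>lborel) =
        (\<integral>\<^sup>+t. F (cos s) (cos t) * ennreal (w (cos s) * w (cos t)) * ennreal (sin s * sin t)
         * indicator {0..pi} t \<partial>lborel)" if "s \<in> {0..pi}" for s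
      using that by (intro nn_integral_cong) (simp split: split_indicator)
    then show ?thesis
      by (intro nn_integral_cong) (simp split: split_indicator)
  qed
  also have "\<dots> = (\<integral>\<^sup>+z. (case z of (u, v) \<Rightarrow> F u v * ennreal (w u * w v)) * indicator sq2 z \<partial>lborel)"
    by (rule nn_integral_square_cos_substitution[symmetric]) (simp add: borel_prod[symmetric])
  finally show ?thesis by (simp add: case_prod_unfold w_def)
qed

lemma ennreal_mult_indicator_pos:
  "ennreal (indicator A z * (a * b)) = ennreal a * ennreal b * indicator A z" if "b \<ge> 0"
  using that by (simp add: ennreal_mult'' split: split_indicator)

lemma ennreal_mult_indicator_neg:
  "ennreal (- (indicator A z * (a * b))) = ennreal (- a) * ennreal b * indicator A z" if "b \<ge> 0"
  using ennreal_mult''[OF that, of "- a"] by (simp split: split_indicator)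

text \<open>
  The positive and negative parts of \<open>F\<close> and \<open>f\<close> correspond to each other, so the signed version
  follows from the nonnegative one.
\<close>

theorem set_integral_rotated_weight:
  fixes F :: "real \<Rightarrow> real \<Rightarrow> real" and f :: "real \<times> real \<Rightarrow> real"
  assumes [measurable]: "case_prod F \<in> borel_measurable borel" "f \<in> borel_measurable borel"
    and sym: "\<And>u v. F v u = F u v"
    and f: "\<And>s t. s \<in> {0..pi} \<Longrightarrow> t \<in> {0..pi} \<Longrightarrow> f (cos s, cos t) = F (cos (s - t)) (cos (s + t))"
    and int: "set_integrable lborel sq2 (\<lambda>(u, v). F u v * (jacobi_weight \<alpha> \<beta> u * jacobi_weight \<alpha> \<beta> v))"
  shows "set_integrable lborel sq2 (\<lambda>z. f z * rotated_weight \<alpha> \<beta> z)"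
    and "(LINT z:sq2|lborel. f z * rotated_weight \<alpha> \<beta> z) =
      (LINT (u, v):sq2|lborel. F u v * (jacobi_weight \<alpha> \<beta> u * jacobi_weight \<alpha> \<beta> v))"
proof -
  let ?g = "\<lambda>z. indicator sq2 z * (f z * rotated_weight \<alpha> \<beta> z)"
  let ?G = "\<lambda>(u, v). indicator sq2 (u, v) * (F u v * (jacobi_weight \<alpha> \<beta> u * jacobi_weight \<alpha> \<beta> v))"
  have nn: "(\<integral>\<^sup>+z. ennreal (h (f z)) * ennreal (rotated_weight \<alpha> \<beta> z) * indicator sq2 z \<partial>lborel) =
    (\<integral>\<^sup>+(u, v). ennreal (h (F u v)) * ennreal (jacobi_weight \<alpha> \<beta> u * jacobi_weight \<alpha> \<beta> v) * indicator sq2 (u, v) \<partial>lborel)"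
    if [measurable]: "h \<in> borel_measurable borel" for h :: "real \<Rightarrow> real"
  proof (rule nn_integral_rotated_weight)
    have "(\<lambda>z. ennreal (h (case_prod F z))) \<in> borel_measurable borel" by measurable
    then show "(\<lambda>(u, v). ennreal (h (F u v))) \<in> borel_measurable borel"
      by (simp add: case_prod_unfold)
  qed (auto simp: f sym)
  have w0: "jacobi_weight \<alpha> \<beta> u * jacobi_weight \<alpha> \<beta> v \<ge> 0" for u v by (simp add: jacobi_weight_nonneg)
  have G: "integrable lborel ?G"
    using int by (simp add: set_integrable_def case_prod_unfold)
  have P: "(\<integral>\<^sup>+z. ennreal (?g z) \<partial>lborel) = (\<integral>\<^sup>+z. ennreal (?G z) \<partial>lborel)"
    using nn[of "\<lambda>x. x", OF measurable_ident_sets[OF refl]]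
    by (simp only: ennreal_mult_indicator_pos[OF rotated_weight_nonneg] ennreal_mult_indicator_pos[OF w0]
        case_prod_unfold prod.collapse)
  have N: "(\<integral>\<^sup>+z. ennreal (- ?g z) \<partial>lborel) = (\<integral>\<^sup>+z. ennreal (- ?G z) \<partial>lborel)"
    using nn[of uminus, OF borel_measurable_uminus[OF measurable_ident_sets[OF refl]]]
    by (simp only: ennreal_mult_indicator_neg[OF rotated_weight_nonneg] ennreal_mult_indicator_neg[OF w0]
        case_prod_unfold prod.collapse borel_measurable_uminus_eq measurable_ident simp_thms)
  have g: "integrable lborel ?g"
    unfolding real_integrable_def P N using G[unfolded real_integrable_def] by simp
  show "set_integrable lborel sq2 (\<lambda>z. f z * rotated_weight \<alpha> \<beta> z)"
    using g by (simp add: set_integrable_def)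
  have "integral\<^sup>L lborel ?g = integral\<^sup>L lborel ?G"
    unfolding real_lebesgue_integral_def[OF g] real_lebesgue_integral_def[OF G] P N ..
  then show "(LINT z:sq2|lborel. f z * rotated_weight \<alpha> \<beta> z) =
      (LINT (u, v):sq2|lborel. F u v * (jacobi_weight \<alpha> \<beta> u * jacobi_weight \<alpha> \<beta> v))"
    by (simp add: set_lebesgue_integral_def case_prod_unfold)
qed

section \<open>Linear independence and bivariate polynomials\<close>

global_interpretation fun_space: vector_space "\<lambda>(c :: real) (f :: 'a \<Rightarrow> real) z. c * f z"
  by unfold_locales (simp_all add: fun_eq_iff algebra_simps)

lemma sum_fun_apply: "(\<Sum>i\<in>A. f i) z = (\<Sum>i\<in>A. f i z)" for f :: "'i \<Rightarrow> 'a \<Rightarrow> real"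
  by (induction A rule: infinite_finite_induct) auto

text \<open>
  A family with a dual family of functionals is linearly independent. If it has as many members as
  a spanning set, it spans as well, since an element outside its span could be added to give an
  independent set that is too large. The functionals \<open>\<phi> j\<close> are evaluated on linear combinations
  of the family only.
\<close>

lemma dual_family_spans:
  fixes e :: "'i \<Rightarrow> 'a \<Rightarrow> real" and \<phi> :: "'i \<Rightarrow> ('a \<Rightarrow> real) \<Rightarrow> real"
  assumes fin: "finite I" "finite B" and card: "card B \<le> card I"
    and e: "\<And>i. i \<in> I \<Longrightarrow> e i \<in> fun_space.span B"
    and dual: "\<And>c j. j \<in> I \<Longrightarrow> \<phi> j (\<lambda>z. \<Sum>i\<in>I. c i * e i z) = c j"
    and f: "f \<in> fun_space.span B"
  shows "\<exists>c. f = (\<lambda>z. \<Sum>i\<in>I. c i * e i z)"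
proof -
  have coeffs_eq: "c j = d j"
    if "(\<lambda>z. \<Sum>i\<in>I. c i * e i z) = (\<lambda>z. \<Sum>i\<in>I. d i * e i z)" "j \<in> I" for c d :: "'i \<Rightarrow> real" and j
    using dual[OF that(2), of c] dual[OF that(2), of d] that(1) by simp
  have inj: "inj_on e I"
  proof (rule inj_onI, rule ccontr)
    fix i j assume ij: "i \<in> I" "j \<in> I" "e i = e j" "i \<noteq> j"
    have "(\<Sum>k\<in>I. (if k = l then 1 else 0) * e k z) = e l z" if "l \<in> I" for l z
      using that fin(1) by (simp add: if_distrib[of "\<lambda>x. x * _"] cong: if_cong)
    then have "(\<lambda>z. \<Sum>k\<in>I. (if k = i then 1 else 0) * e k z) =
        (\<lambda>z. \<Sum>k\<in>I. (if k = j then 1 else 0) * e k z)"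
      using ij by simp
    from coeffs_eq[OF this ij(1)] ij(4) show False by simp
  qed
  have sum_e: "(\<Sum>v\<in>e ` I. (\<lambda>z. u v * v z)) = (\<lambda>z. \<Sum>i\<in>I. u (e i) * e i z)" for u
    by (simp add: sum.reindex[OF inj] fun_eq_iff sum_fun_apply)
  have indep: "fun_space.independent (e ` I)"
  proof (rule fun_space.independent_if_scalars_zero)
    fix u x assume "(\<Sum>v\<in>e ` I. (\<lambda>z. u v * v z)) = 0" and "x \<in> e ` I"
    then obtain j where j: "j \<in> I" "x = e j" by blast
    have "(\<lambda>z. \<Sum>i\<in>I. u (e i) * e i z) = (\<lambda>z. \<Sum>i\<in>I. 0 * e i z)"
      using \<open>_ = 0\<close> by (simp add: sum_e fun_eq_iff)
    from coeffs_eq[OF this j(1)] j(2) show "u x = 0" by simp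
  qed (use fin in simp)
  have "f \<in> fun_space.span (e ` I)"
  proof (rule ccontr)
    assume notin: "f \<notin> fun_space.span (e ` I)"
    then have indep': "fun_space.independent (insert f (e ` I))"
      using indep by (simp add: fun_space.independent_insert)
    have "insert f (e ` I) \<subseteq> fun_space.span B" using f e by auto
    from fun_space.independent_span_bound[OF fin(2) indep' this]
    have "card (insert f (e ` I)) \<le> card B" by (rule conjunct2)
    moreover have "f \<notin> e ` I" using notin fun_space.span_base[of f "e ` I"] by (rule contrapos_nn)
    ultimately show False using fin(1) card card_image[OF inj] by simp
  qed
  then obtain u where "f = (\<Sum>v\<in>e ` I. (\<lambda>z. u v * v z))"
    unfolding fun_space.span_finite[OF finite_imageI[OF fin(1)]] by blast
  then have "f = (\<lambda>z. \<Sum>i\<in>I. u (e i) * e i z)" unfolding sum_e .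
  then show ?thesis by (rule exI[where x="\<lambda>i. u (e i)"])
qed

definition monomials :: "nat \<Rightarrow> (real \<times> real \<Rightarrow> real) set" where
  "monomials m = (\<lambda>(i, j) z. fst z ^ i * snd z ^ j) ` (SIGMA i:{..m}. {..m - i})"

lemma finite_monomials: "finite (monomials m)"
  unfolding monomials_def by simp

lemma card_monomials_le: "card (monomials m) \<le> (\<Sum>d\<le>m. d + 1)"
proof -
  have "card (monomials m) \<le> card (SIGMA i:{..m}. {..m - i})"
    unfolding monomials_def by (rule card_image_le) simp
  also have "\<dots> = (\<Sum>i\<le>m. (m - i) + 1)" by simp
  also have "\<dots> = (\<Sum>d\<le>m. d + 1)"
    using sum.nat_diff_reindex[of "\<lambda>d. d + 1" "Suc m"] by (simp add: lessThan_Suc_atMost)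
  finally show ?thesis .
qed

lemma polys2_eq_span: "polys2 m = fun_space.span (monomials m)"
proof (intro equalityI subsetI)
  fix f assume "f \<in> polys2 m"
  then obtain c where "f = (\<lambda>(x, y). \<Sum>i\<le>m. \<Sum>j\<le>m - i. c i j * x ^ i * y ^ j)"
    by (auto simp: polys2_def)
  then have "f = (\<Sum>i\<le>m. \<Sum>j\<le>m - i. (\<lambda>z. c i j * (fst z ^ i * snd z ^ j)))"
    by (simp add: fun_eq_iff sum_fun_apply mult.assoc)
  also have "\<dots> \<in> fun_space.span (monomials m)"
    by (intro fun_space.span_sum fun_space.span_scale fun_space.span_base)
       (force simp: monomials_def)
  finally show "f \<in> fun_space.span (monomials m)" .
next
  have "monomials m \<subseteq> polys2 m"
  proof
    fix f assume "f \<in> monomials m"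
    then obtain a b where ab: "a \<le> m" "b \<le> m - a" "f = (\<lambda>z. fst z ^ a * snd z ^ b)"
      by (auto simp: monomials_def)
    have eq: "(\<Sum>i\<le>m. \<Sum>j\<le>m - i. (if i = a \<and> j = b then 1 else 0) * x ^ i * y ^ j) = x ^ a * y ^ b"
      for x y :: real
    proof -
      have "(\<Sum>j\<le>m - i. (if i = a \<and> j = b then 1 else 0) * x ^ i * y ^ j) =
          (if i = a then x ^ a * y ^ b else 0)" for i
      proof (cases "i = a")
        case True
        have "(\<Sum>j\<le>m - a. (if j = b then 1 else 0) * x ^ a * y ^ j) =
            (\<Sum>j\<le>m - a. if j = b then x ^ a * y ^ b else 0)"
          by (intro sum.cong) auto
        also have "\<dots> = x ^ a * y ^ b" using ab(2) by simp
        finally show ?thesis using True by simp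
      qed simp
      then show ?thesis using ab(1) by simp
    qed
    have "f = (\<lambda>(x, y). \<Sum>i\<le>m. \<Sum>j\<le>m - i. (if i = a \<and> j = b then 1 else 0) * x ^ i * y ^ j)"
    proof
      fix z :: "real \<times> real"
      show "f z = (case z of (x, y) \<Rightarrow> \<Sum>i\<le>m. \<Sum>j\<le>m - i. (if i = a \<and> j = b then 1 else 0) * x ^ i * y ^ j)"
        by (cases z) (simp only: ab(3) prod.case fst_conv snd_conv eq)
    qed
    then show "f \<in> polys2 m" unfolding polys2_def by (intro CollectI exI[where x="\<lambda>i j. if i = a \<and> j = b then 1 else 0"])
  qed
  moreover have "fun_space.subspace (polys2 m)"
  proof (rule fun_space.subspaceI)
    have "(0 :: real \<times> real \<Rightarrow> real) = (\<lambda>(x, y). \<Sum>i\<le>m. \<Sum>j\<le>m - i. 0 * x ^ i * y ^ j)"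
      by (simp add: fun_eq_iff)
    then show "0 \<in> polys2 m" unfolding polys2_def by (intro CollectI exI[where x="\<lambda>i j. 0"])
  next
    fix f g assume "f \<in> polys2 m" "g \<in> polys2 m"
    then obtain c d where "f = (\<lambda>(x, y). \<Sum>i\<le>m. \<Sum>j\<le>m - i. c i j * x ^ i * y ^ j)"
        "g = (\<lambda>(x, y). \<Sum>i\<le>m. \<Sum>j\<le>m - i. d i j * x ^ i * y ^ j)"
      by (auto simp: polys2_def)
    then have "f + g = (\<lambda>(x, y). \<Sum>i\<le>m. \<Sum>j\<le>m - i. (c i j + d i j) * x ^ i * y ^ j)"
      by (simp add: fun_eq_iff distrib_right sum.distrib)
    then show "f + g \<in> polys2 m" unfolding polys2_def by (intro CollectI exI[where x="\<lambda>i j. c i j + d i j"])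
  next
    fix a f assume "f \<in> polys2 m"
    then obtain c where "f = (\<lambda>(x, y). \<Sum>i\<le>m. \<Sum>j\<le>m - i. c i j * x ^ i * y ^ j)"
      by (auto simp: polys2_def)
    then have "(\<lambda>z. a * f z) = (\<lambda>(x, y). \<Sum>i\<le>m. \<Sum>j\<le>m - i. (a * c i j) * x ^ i * y ^ j)"
      by (simp add: fun_eq_iff sum_distrib_left mult.assoc)
    then show "(\<lambda>z. a * f z) \<in> polys2 m" unfolding polys2_def by (intro CollectI exI[where x="\<lambda>i j. a * c i j"])
  qed
  ultimately show "f \<in> polys2 m" if "f \<in> fun_space.span (monomials m)" for f
    using that fun_space.span_minimal by blast
qed

lemma polys2_add: "f \<in> polys2 m \<Longrightarrow> g \<in> polys2 m \<Longrightarrow> (\<lambda>z. f z + g z) \<in> polys2 m"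
  using fun_space.span_add[of f "monomials m" g] by (simp add: polys2_eq_span plus_fun_def)

lemma polys2_diff: "f \<in> polys2 m \<Longrightarrow> g \<in> polys2 m \<Longrightarrow> (\<lambda>z. f z - g z) \<in> polys2 m"
  using fun_space.span_diff[of f "monomials m" g] by (simp add: polys2_eq_span fun_diff_def)

lemma polys2_scale: "f \<in> polys2 m \<Longrightarrow> (\<lambda>z. a * f z) \<in> polys2 m"
  using fun_space.span_scale[of f "monomials m" a] by (simp add: polys2_eq_span)

lemma polys2_sum: "(\<And>i. i \<in> A \<Longrightarrow> f i \<in> polys2 m) \<Longrightarrow> (\<lambda>z. \<Sum>i\<in>A. f i z) \<in> polys2 m"
  using fun_space.span_sum[of A f "monomials m"]
  by (simp add: polys2_eq_span sum_fun_apply[abs_def])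

lemma polys2_mono: "f \<in> polys2 m \<Longrightarrow> m \<le> n \<Longrightarrow> f \<in> polys2 n"
proof -
  assume f: "f \<in> polys2 m" and "m \<le> n"
  then have "monomials m \<subseteq> monomials n"
    unfolding monomials_def by (intro image_mono Sigma_mono) auto
  with f show ?thesis unfolding polys2_eq_span using fun_space.span_mono by blast
qed

lemma polys2_const: "(\<lambda>z. c) \<in> polys2 m"
proof -
  have "(\<lambda>z. 1 :: real) \<in> monomials m"
    unfolding monomials_def by (rule image_eqI[where x="(0, 0)"]) auto
  then have "(\<lambda>z. 1 :: real) \<in> polys2 m"
    unfolding polys2_eq_span by (rule fun_space.span_base)
  from polys2_scale[OF this, of c] show ?thesis by simp
qed

text \<open>
  Multiplication by a fixed function is linear, so it is enough to look at monomials.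
\<close>

lemma polys2_mult:
  assumes "f \<in> polys2 m" and h: "\<And>g. g \<in> monomials m \<Longrightarrow> (\<lambda>z. h z * g z) \<in> monomials n"
  shows "(\<lambda>z. h z * f z) \<in> polys2 n"
  using assms(1) unfolding polys2_eq_span
proof (rule fun_space.span_induct)
  show "fun_space.subspace {f. (\<lambda>z. h z * f z) \<in> fun_space.span (monomials n)}"
  proof (rule fun_space.subspaceI; unfold mem_Collect_eq)
    show "(\<lambda>z. h z * 0 z) \<in> fun_space.span (monomials n)"
      using fun_space.span_zero[of "monomials n"] by (simp add: zero_fun_def)
    show "(\<lambda>z. h z * (f + g) z) \<in> fun_space.span (monomials n)"
      if "(\<lambda>z. h z * f z) \<in> fun_space.span (monomials n)" "(\<lambda>z. h z * g z) \<in> fun_space.span (monomials n)" for f g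
      using fun_space.span_add[OF that] by (simp add: plus_fun_def distrib_left)
    show "(\<lambda>z. h z * (a * f z)) \<in> fun_space.span (monomials n)"
      if "(\<lambda>z. h z * f z) \<in> fun_space.span (monomials n)" for a f
      using fun_space.span_scale[OF that, of a] by (simp add: mult.left_commute)
  qed
qed (use h in \<open>auto intro: fun_space.span_base\<close>)

lemma polys2_mult_fst: "f \<in> polys2 m \<Longrightarrow> (\<lambda>z. fst z * f z) \<in> polys2 (Suc m)"
proof (erule polys2_mult)
  fix g :: "real \<times> real \<Rightarrow> real" assume "g \<in> monomials m"
  then obtain i j where "i \<le> m" "j \<le> m - i" "g = (\<lambda>z. fst z ^ i * snd z ^ j)"
    by (auto simp: monomials_def)
  then show "(\<lambda>z. fst z * g z) \<in> monomials (Suc m)"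
    unfolding monomials_def by (intro image_eqI[where x="(Suc i, j)"]) (auto simp: mult.assoc)
qed

lemma polys2_mult_snd: "f \<in> polys2 m \<Longrightarrow> (\<lambda>z. snd z * f z) \<in> polys2 (Suc m)"
proof (erule polys2_mult)
  fix g :: "real \<times> real \<Rightarrow> real" assume "g \<in> monomials m"
  then obtain i j where "i \<le> m" "j \<le> m - i" "g = (\<lambda>z. fst z ^ i * snd z ^ j)"
    by (auto simp: monomials_def)
  then show "(\<lambda>z. snd z * g z) \<in> monomials (Suc m)"
    unfolding monomials_def by (intro image_eqI[where x="(i, Suc j)"]) (auto simp: mult_ac)
qed

lemma polys2_mult_xy: "f \<in> polys2 m \<Longrightarrow> (\<lambda>z. 2 * fst z * snd z * f z) \<in> polys2 (m + 2)"
  using polys2_scale[OF polys2_mult_fst[OF polys2_mult_snd], of f m 2] by (simp add: mult.assoc)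

lemma polys2_mult_norm: "f \<in> polys2 m \<Longrightarrow> (\<lambda>z. ((fst z)\<^sup>2 + (snd z)\<^sup>2 - 1) * f z) \<in> polys2 (m + 2)"
proof -
  assume f: "f \<in> polys2 m"
  have "(\<lambda>z. fst z * (fst z * f z) + snd z * (snd z * f z)) \<in> polys2 (m + 2)"
    using polys2_add[OF polys2_mult_fst[OF polys2_mult_fst[OF f]] polys2_mult_snd[OF polys2_mult_snd[OF f]]]
    by simp
  from polys2_diff[OF this polys2_mono[OF f]] show ?thesis
    by (simp add: power2_eq_square distrib_right left_diff_distrib mult.assoc)
qed

lemma polys2_mult_linear_power:
  assumes "f \<in> polys2 m" shows "(\<lambda>z. (fst z + a * snd z) ^ i * f z) \<in> polys2 (m + i)"
proof (induction i)
  case (Suc i)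
  from polys2_add[OF polys2_mult_fst[OF Suc] polys2_scale[OF polys2_mult_snd[OF Suc], of a]]
  show ?case by (simp add: algebra_simps)
qed (use assms in simp)

section \<open>Symmetric polynomials in the rotated cosines\<close>

text \<open>
  Newton's recursion for \<open>u ^ n + v ^ n\<close> in terms of \<open>u + v = 2 x y\<close> and \<open>u v = x\<^sup>2 + y\<^sup>2 - 1\<close>. The values
  \<open>u = cos (\<theta> - \<phi>)\<close> and \<open>v = cos (\<theta> + \<phi>)\<close> are available on the square \<open>sq2\<close> only, whereas the
  recursion makes sense, as a polynomial, at every point of the plane.
\<close>

fun power_sum :: "nat \<Rightarrow> real \<times> real \<Rightarrow> real" where
  "power_sum 0 z = 2"
| "power_sum (Suc 0) z = 2 * fst z * snd z"
| "power_sum (Suc (Suc n)) z =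
     2 * fst z * snd z * power_sum (Suc n) z - ((fst z)\<^sup>2 + (snd z)\<^sup>2 - 1) * power_sum n z"

text \<open>
  The function \<open>u ^ i * v ^ j + u ^ j * v ^ i\<close>, with the common power of \<open>u v\<close> taken out.
\<close>

definition sym_monomial :: "nat \<Rightarrow> nat \<Rightarrow> real \<times> real \<Rightarrow> real" where
  "sym_monomial i j z =
     ((fst z)\<^sup>2 + (snd z)\<^sup>2 - 1) ^ min i j * power_sum (max i j - min i j) z"

text \<open>
  The function \<open>p(u) q(v) + q(u) p(v)\<close>.
\<close>

definition sym_product :: "real poly \<Rightarrow> real poly \<Rightarrow> real \<times> real \<Rightarrow> real" where
  "sym_product p q z =
     (\<Sum>i\<le>degree p. \<Sum>j\<le>degree q. coeff p i * coeff q j * sym_monomial i j z)"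

lemma power_sum_in_polys2: "power_sum n \<in> polys2 (2 * n)"
proof (induction n rule: induct_nat_012)
  case 0
  then show ?case using polys2_const[of 2 0] by (simp add: power_sum.simps(1)[abs_def])
next
  case 1
  then show ?case using polys2_mult_xy[OF polys2_const[of 1 0]]
    by (simp add: power_sum.simps(2)[abs_def] numeral_2_eq_2)
next
  case (ge2 n)
  have "(\<lambda>z. ((fst z)\<^sup>2 + (snd z)\<^sup>2 - 1) * power_sum n z) \<in> polys2 (2 * Suc (Suc n))"
    by (rule polys2_mono[OF polys2_mult_norm[OF ge2(1)]]) simp
  then show ?case using polys2_diff[OF polys2_mult_xy[OF ge2(2)]]
    by (simp add: power_sum.simps(3)[abs_def])
qed

text \<open>
  Both \<open>u + v\<close> and \<open>u v\<close> have degree 2 in \<open>x\<close> and \<open>y\<close>. So \<open>u v\<close>, although quadratic in \<open>u\<close> and \<open>v\<close>, costs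
  no more than \<open>u + v\<close>, and the degree is bounded by twice the maximum of \<open>i\<close> and \<open>j\<close>, not twice
  their sum. This is why \<open>p_n\<close> and \<open>p_k\<close> together give degree at most \<open>2 * n\<close> for every \<open>k \<le> n\<close>.
\<close>

lemma sym_monomial_in_polys2: "sym_monomial i j \<in> polys2 (2 * max i j)"
proof -
  have "(\<lambda>z. ((fst z)\<^sup>2 + (snd z)\<^sup>2 - 1) ^ k * power_sum n z) \<in> polys2 (2 * (n + k))" for k n
  proof (induction k)
    case 0
    then show ?case using power_sum_in_polys2[of n] by simp
  next
    case (Suc k)
    from polys2_mult_norm[OF this] show ?case by (simp add: mult.assoc)
  qed
  from this[of "min i j" "max i j - min i j"] show ?thesis
    by (simp add: sym_monomial_def[abs_def] max_def min_def split: if_splits)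
qed

lemma sym_product_in_polys2:
  assumes "degree p \<le> n" "degree q \<le> n" shows "sym_product p q \<in> polys2 (2 * n)"
  unfolding sym_product_def[abs_def]
proof (intro polys2_sum polys2_scale)
  fix i j assume "i \<in> {..degree p}" "j \<in> {..degree q}"
  then show "sym_monomial i j \<in> polys2 (2 * n)"
    using assms by (intro polys2_mono[OF sym_monomial_in_polys2]) auto
qed

lemma power_sum_eq:
  assumes "u + v = 2 * fst z * snd z" "u * v = (fst z)\<^sup>2 + (snd z)\<^sup>2 - 1"
  shows "power_sum n z = u ^ n + v ^ n"
proof (induction n rule: induct_nat_012)
  case (ge2 n)
  have "power_sum (Suc (Suc n)) z = (u + v) * power_sum (Suc n) z - u * v * power_sum n z"
    by (simp add: assms)
  also have "\<dots> = u ^ Suc (Suc n) + v ^ Suc (Suc n)"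
    unfolding ge2 by (simp add: algebra_simps)
  finally show ?case .
qed (use assms in simp_all)

lemma sym_monomial_eq:
  assumes "u + v = 2 * fst z * snd z" "u * v = (fst z)\<^sup>2 + (snd z)\<^sup>2 - 1"
  shows "sym_monomial i j z = u ^ i * v ^ j + u ^ j * v ^ i"
proof -
  have "sym_monomial i j z = (u * v) ^ min i j * (u ^ (max i j - min i j) + v ^ (max i j - min i j))"
    by (simp only: sym_monomial_def power_sum_eq[OF assms] assms(2))
  also have "\<dots> = u ^ max i j * v ^ min i j + u ^ min i j * v ^ max i j"
  proof -
    have "a ^ max i j = a ^ min i j * a ^ (max i j - min i j)" for a :: real
      by (simp flip: power_add)
    then show ?thesis by (simp add: algebra_simps power_mult_distrib)
  qed
  also have "\<dots> = u ^ i * v ^ j + u ^ j * v ^ i"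
    by (simp add: max_def min_def)
  finally show ?thesis .
qed

lemma sym_product_eq:
  assumes "u + v = 2 * fst z * snd z" "u * v = (fst z)\<^sup>2 + (snd z)\<^sup>2 - 1"
  shows "sym_product p q z = poly p u * poly q v + poly q u * poly p v"
proof -
  have "sym_product p q z = (\<Sum>i\<le>degree p. \<Sum>j\<le>degree q. coeff p i * u ^ i * (coeff q j * v ^ j)) +
     (\<Sum>i\<le>degree p. \<Sum>j\<le>degree q. coeff p i * v ^ i * (coeff q j * u ^ j))"
    by (simp add: sym_product_def sym_monomial_eq[OF assms] sum.distrib[symmetric] algebra_simps)
  also have "\<dots> = poly p u * poly q v + poly p v * poly q u"
    by (simp add: poly_altdef sum_product)
  finally show ?thesis by simp
qed

lemma sym_product_cos:
  "sym_product p q (cos s, cos t) =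
     poly p (cos (s - t)) * poly q (cos (s + t)) + poly q (cos (s - t)) * poly p (cos (s + t))"
proof (rule sym_product_eq)
  show "cos (s - t) + cos (s + t) = 2 * fst (cos s, cos t) * snd (cos s, cos t)"
    by (simp add: cos_add cos_diff)
  have "cos (s - t) * cos (s + t) = (cos s)\<^sup>2 * (cos t)\<^sup>2 - (sin s)\<^sup>2 * (sin t)\<^sup>2"
    by (simp add: cos_add cos_diff algebra_simps power2_eq_square)
  also have "\<dots> = (cos s)\<^sup>2 * (cos t)\<^sup>2 - (1 - (cos s)\<^sup>2) * (1 - (cos t)\<^sup>2)"
    by (simp add: sin_squared_eq)
  finally show "cos (s - t) * cos (s + t) = (fst (cos s, cos t))\<^sup>2 + (snd (cos s, cos t))\<^sup>2 - 1"
    by (simp add: algebra_simps)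
qed

lemma power_sum_symmetries:
  shows "power_sum n (y, x) = power_sum n (x, y)" and "power_sum n (- z) = power_sum n z"
  by (induction n rule: induct_nat_012) (simp_all add: algebra_simps)

lemma sym_product_symmetries:
  shows sym_product_swap: "sym_product p q (y, x) = sym_product p q (x, y)"
    and sym_product_uminus: "sym_product p q (- z) = sym_product p q z"
proof -
  have "sym_monomial i j (y, x) = sym_monomial i j (x, y)" for i j
    using power_sum_symmetries(1)[of "max i j - min i j" y x]
    by (simp add: sym_monomial_def add.commute)
  then show "sym_product p q (y, x) = sym_product p q (x, y)"
    by (simp add: sym_product_def)
  show "sym_product p q (- z) = sym_product p q z"
    by (simp add: sym_product_def sym_monomial_def power_sum_symmetries(2))
qed

section \<open>The inner product on the square\<close>

lemma polys2_continuous: "f \<in> polys2 m \<Longrightarrow> continuous_on UNIV f"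
  by (auto simp: polys2_def case_prod_unfold intro!: continuous_intros)

lemma polys2_measurable: "f \<in> polys2 m \<Longrightarrow> f \<in> borel_measurable borel"
  by (rule borel_measurable_continuous_onI) (rule polys2_continuous)

lemma polys2_bounded:
  assumes "f \<in> polys2 m" obtains B where "\<And>z. z \<in> sq2 \<Longrightarrow> \<bar>f z\<bar> \<le> B"
proof -
  have "compact sq2" unfolding sq2_def by (intro compact_Times) auto
  then have "bounded (f ` sq2)"
    using polys2_continuous[OF assms]
    by (intro compact_imp_bounded compact_continuous_image) (auto intro: continuous_on_subset)
  then obtain B where "\<forall>z\<in>sq2. \<bar>f z\<bar> \<le> B" unfolding bounded_iff by auto
  then show ?thesis using that by blast
qed

lemma set_integrable_W_weight:
  assumes "\<alpha> > -1" "\<beta> > -1"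
  shows "set_integrable lborel sq2 (W_weight \<alpha> \<beta>)"
proof -
  have "set_integrable lborel sq2 (\<lambda>z. 1 * rotated_weight \<alpha> \<beta> z)"
  proof (rule set_integral_rotated_weight(1))
    show "set_integrable lborel sq2 (\<lambda>(u, v). 1 * (jacobi_weight \<alpha> \<beta> u * jacobi_weight \<alpha> \<beta> v))"
      using set_integral_poly_product(1)[OF assms, of 1 1] by simp
  qed simp_all
  then have "set_integrable lborel sq2 (\<lambda>z. a_const \<alpha> \<beta> (-1/2) * rotated_weight \<alpha> \<beta> z)"
    by (intro set_integrable_mult_right) simp
  then show ?thesis by (simp add: W_weight_eq[abs_def])
qed

lemma inner_w_integrable:
  assumes "\<alpha> > -1" "\<beta> > -1" and f: "f \<in> polys2 m" and g: "g \<in> polys2 n"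
  shows "set_integrable lborel sq2 (\<lambda>z. f z * g z * W_weight \<alpha> \<beta> z)"
proof -
  obtain B where B: "\<And>z. z \<in> sq2 \<Longrightarrow> \<bar>f z\<bar> \<le> B" using polys2_bounded[OF f] by blast
  obtain C where C: "\<And>z. z \<in> sq2 \<Longrightarrow> \<bar>g z\<bar> \<le> C" using polys2_bounded[OF g] by blast
  show ?thesis
  proof (rule set_integrable_bounded_mult)
    show "\<bar>f z * g z\<bar> \<le> \<bar>B\<bar> * \<bar>C\<bar>" if "z \<in> sq2" for z
      unfolding abs_mult using B[OF that] C[OF that] by (intro mult_mono) auto
  qed (use polys2_measurable[OF f] polys2_measurable[OF g] set_integrable_W_weight[OF assms(1,2)] in auto)
qed

lemma inner_w_commute: "inner_w w f g = inner_w w g f"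
  by (simp add: inner_w_def mult.commute[of "f _"])

lemma inner_w_sum_left:
  assumes "\<alpha> > -1" "\<beta> > -1" and e: "\<And>i. i \<in> I \<Longrightarrow> e i \<in> polys2 m" and g: "g \<in> polys2 n"
  shows "inner_w (W_weight \<alpha> \<beta>) (\<lambda>z. \<Sum>i\<in>I. c i * e i z) g =
     (\<Sum>i\<in>I. c i * inner_w (W_weight \<alpha> \<beta>) (e i) g)"
proof -
  have int: "integrable lborel (\<lambda>z. indicator sq2 z * (e i z * g z * W_weight \<alpha> \<beta> z))" if "i \<in> I" for i
    using inner_w_integrable[OF assms(1,2) e[OF that] g] by (simp add: set_integrable_def)
  have "inner_w (W_weight \<alpha> \<beta>) (\<lambda>z. \<Sum>i\<in>I. c i * e i z) g =
     (\<integral>z. (\<Sum>i\<in>I. c i * (indicator sq2 z * (e i z * g z * W_weight \<alpha> \<beta> z))) \<partial>lborel)"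
    unfolding inner_w_def set_lebesgue_integral_def
    by (simp add: sum_distrib_left sum_distrib_right mult_ac)
  also have "\<dots> = (\<Sum>i\<in>I. c i * (\<integral>z. indicator sq2 z * (e i z * g z * W_weight \<alpha> \<beta> z) \<partial>lborel))"
    using int by (subst Bochner_Integration.integral_sum) simp_all
  finally show ?thesis by (simp add: inner_w_def set_lebesgue_integral_def)
qed

text \<open>
  In the coordinates \<open>(u, v)\<close> the weight is a product and \<open>a_const = (jacobi_c)\<^sup>2\<close>, so each of the four
  terms of \<open>(p(u) q(v) + q(u) p(v)) (r(u) s(v) + s(u) r(v))\<close> integrates to a product of two
  one-dimensional integrals. The factor 2 appears because exchanging \<open>u\<close> and \<open>v\<close> pairs the terms.
\<close>

lemma inner_w_sym_product:
  assumes ab: "\<alpha> > -1" "\<beta> > -1"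
  shows "inner_w (W_weight \<alpha> \<beta>) (sym_product p q) (sym_product r s) =
    2 * (jacobi_functional \<alpha> \<beta> (p * r) * jacobi_functional \<alpha> \<beta> (q * s) +
         jacobi_functional \<alpha> \<beta> (p * s) * jacobi_functional \<alpha> \<beta> (q * r))"
proof -
  define F where "F u v = (poly p u * poly q v + poly q u * poly p v) *
      (poly r u * poly s v + poly s u * poly r v)" for u v
  define K where "K a b = (\<lambda>(x, y). poly a x * poly b y * (jacobi_weight \<alpha> \<beta> x * jacobi_weight \<alpha> \<beta> y))"
    for a b :: "real poly"
  have K: "set_integrable lborel sq2 (K a b)"
      "(jacobi_c \<alpha> \<beta>)\<^sup>2 * (LINT z:sq2|lborel. K a b z) = jacobi_functional \<alpha> \<beta> a * jacobi_functional \<alpha> \<beta> b"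
    for a b
    using set_integral_poly_product[OF ab, of a b] by (simp_all add: K_def case_prod_unfold)
  have FK: "(\<lambda>(u, v). F u v * (jacobi_weight \<alpha> \<beta> u * jacobi_weight \<alpha> \<beta> v)) =
      (\<lambda>z. (K (p * r) (q * s) z + K (q * s) (p * r) z) + (K (p * s) (q * r) z + K (q * r) (p * s) z))"
    by (auto simp: F_def K_def fun_eq_iff algebra_simps)
  have F_int: "set_integrable lborel sq2 (\<lambda>(u, v). F u v * (jacobi_weight \<alpha> \<beta> u * jacobi_weight \<alpha> \<beta> v))"
    unfolding FK by (intro set_integral_add K)
  have "sym_product a b \<in> borel_measurable borel" for a b
    by (rule polys2_measurable[OF sym_product_in_polys2[OF max.cobounded1 max.cobounded2]])
  note [measurable] = this
  have F_meas: "case_prod F \<in> borel_measurable borel"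
    unfolding F_def borel_prod[symmetric] by measurable
  have "(LINT z:sq2|lborel. (sym_product p q z * sym_product r s z) * rotated_weight \<alpha> \<beta> z) =
      (LINT (u, v):sq2|lborel. F u v * (jacobi_weight \<alpha> \<beta> u * jacobi_weight \<alpha> \<beta> v))"
    by (rule set_integral_rotated_weight(2)[OF F_meas _ _ _ F_int])
       (simp_all add: F_def sym_product_cos algebra_simps)
  also have "\<dots> = (LINT z:sq2|lborel. K (p * r) (q * s) z) + (LINT z:sq2|lborel. K (q * s) (p * r) z) +
      ((LINT z:sq2|lborel. K (p * s) (q * r) z) + (LINT z:sq2|lborel. K (q * r) (p * s) z))"
    unfolding FK by (simp add: set_integral_add K)
  finally have "(jacobi_c \<alpha> \<beta>)\<^sup>2 *
      (LINT z:sq2|lborel. (sym_product p q z * sym_product r s z) * rotated_weight \<alpha> \<beta> z) =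
     2 * (jacobi_functional \<alpha> \<beta> (p * r) * jacobi_functional \<alpha> \<beta> (q * s) +
         jacobi_functional \<alpha> \<beta> (p * s) * jacobi_functional \<alpha> \<beta> (q * r))"
    by (simp only: distrib_left K(2)) (simp add: algebra_simps)
  moreover have "inner_w (W_weight \<alpha> \<beta>) (sym_product p q) (sym_product r s) = (jacobi_c \<alpha> \<beta>)\<^sup>2 *
      (LINT z:sq2|lborel. (sym_product p q z * sym_product r s z) * rotated_weight \<alpha> \<beta> z)"
    unfolding inner_w_def W_weight_eq a_const_eq[OF ab] set_integral_mult_right[symmetric]
    by (simp add: mult_ac)
  ultimately show ?thesis by simp
qed

lemma integral_odd_eq_0:
  fixes h :: "'a::euclidean_space \<Rightarrow> real"
  assumes [measurable]: "h \<in> borel_measurable borel" "\<sigma> \<in> borel_measurable borel"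
    and inv: "distr lborel borel \<sigma> = lborel" and odd: "\<And>z. h (\<sigma> z) = - h z"
  shows "integral\<^sup>L lborel h = 0"
proof -
  have "integral\<^sup>L lborel h = integral\<^sup>L (distr lborel borel \<sigma>) h" by (simp only: inv)
  also have "\<dots> = (\<integral>z. h (\<sigma> z) \<partial>lborel)" by (rule integral_distr) simp_all
  also have "\<dots> = - integral\<^sup>L lborel h" by (simp add: odd)
  finally show ?thesis by simp
qed

lemma distr_lborel_uminus: "distr lborel borel uminus = (lborel :: 'a::euclidean_space measure)"
  using lborel_affine[of "-1" "0 :: 'a"] by (simp add: density_1)

lemma distr_lborel_swap: "distr lborel borel prod.swap = (lborel :: (real \<times> real) measure)"
proof -
  have "distr lborel borel prod.swap =
      distr (lborel \<Otimes>\<^sub>M lborel) (lborel \<Otimes>\<^sub>M lborel) (\<lambda>(x, y). (y, x :: real) :: real \<times> real)"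
    unfolding lborel_prod by (intro distr_cong) auto
  also have "\<dots> = lborel \<Otimes>\<^sub>M lborel" by (rule lborel_pair.distr_pair_swap[symmetric])
  finally show ?thesis by (simp only: lborel_prod)
qed

lemma W_weight_symmetries:
  shows W_weight_swap: "W_weight \<alpha> \<beta> (prod.swap z) = W_weight \<alpha> \<beta> z"
    and W_weight_uminus: "W_weight \<alpha> \<beta> (- z) = W_weight \<alpha> \<beta> z"
proof -
  show "W_weight \<alpha> \<beta> (prod.swap z) = W_weight \<alpha> \<beta> z"
    by (cases z) (simp add: W_weight_def abs_minus_commute add.commute mult_ac)
  have "\<bar>- x - y\<bar> = \<bar>x + y\<bar>" "\<bar>y - x\<bar> = \<bar>x - y\<bar>" for x y :: real by linarith+
  then show "W_weight \<alpha> \<beta> (- z) = W_weight \<alpha> \<beta> z"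
    by (cases z) (simp add: W_weight_def)
qed

lemma W_weight_measurable [measurable]: "W_weight \<alpha> \<beta> \<in> borel_measurable borel"
  unfolding W_weight_eq[abs_def] by measurable

lemma inner_w_odd_eq_0:
  assumes [measurable]: "f \<in> borel_measurable borel" "g \<in> borel_measurable borel"
    and "(\<forall>z. f (- z) * g (- z) = - (f z * g z)) \<or>
         (\<forall>z. f (prod.swap z) * g (prod.swap z) = - (f z * g z))"
  shows "inner_w (W_weight \<alpha> \<beta>) f g = 0"
proof -
  let ?h = "\<lambda>z. indicator sq2 z * (f z * g z * W_weight \<alpha> \<beta> z)"
  have "integral\<^sup>L lborel ?h = 0"
    using assms(3)
  proof
    assume "\<forall>z. f (- z) * g (- z) = - (f z * g z)"
    then have odd: "f (- z) * (g (- z) * w) = - (f z * (g z * w))" for z w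
      by (metis mult.assoc mult_minus_left)
    have "indicator sq2 (- z) = (indicator sq2 z :: real)" for z
      by (cases z) (auto simp: sq2_def indicator_def)
    then show ?thesis
      using odd by (intro integral_odd_eq_0[OF _ _ distr_lborel_uminus])
        (simp_all add: W_weight_symmetries mult.assoc)
  next
    assume "\<forall>z. f (prod.swap z) * g (prod.swap z) = - (f z * g z)"
    then have odd: "f (prod.swap z) * (g (prod.swap z) * w) = - (f z * (g z * w))" for z w
      by (metis mult.assoc mult_minus_left)
    have "indicator sq2 (prod.swap z) = (indicator sq2 z :: real)" for z
      by (cases z) (auto simp: sq2_def indicator_def)
    moreover have "prod.swap \<in> borel_measurable (borel :: (real \<times> real) measure)"
      by (intro borel_measurable_continuous_onI continuous_on_swap)
    ultimately show ?thesis
      using odd by (intro integral_odd_eq_0[OF _ _ distr_lborel_swap])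
        (simp_all add: W_weight_symmetries mult.assoc)
  qed
  then show ?thesis by (simp add: inner_w_def set_lebesgue_integral_def)
qed

section \<open>Orthonormality of the four families\<close>

text \<open>
  The exponents \<open>(i, j)\<close> distinguish the four families: \<open>(0, 0)\<close> and \<open>(1, 1)\<close> are the first and the second family in
  even degree, \<open>(0, 1)\<close> and \<open>(1, 0)\<close> the first and the second one in odd degree. Treating them as one family of total degree
  \<open>i + j + 2 * N\<close> makes it possible to compare members of different degrees.
\<close>

definition jacobi_Q :: "real \<Rightarrow> real \<Rightarrow> nat \<times> nat \<times> nat \<times> nat \<Rightarrow> real \<times> real \<Rightarrow> real" where
  "jacobi_Q \<alpha> \<beta> = (\<lambda>(i, j, N, k) z.
     b_const \<alpha> \<beta> i j / sqrt 2 * (if k = N then 1 / sqrt 2 else 1) *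
     ((fst z - snd z) ^ i * ((fst z + snd z) ^ j *
        sym_product (jacobi_p (\<alpha> + real i) (\<beta> + real j) N) (jacobi_p (\<alpha> + real i) (\<beta> + real j) k) z)))"

definition Q_index :: "nat \<Rightarrow> (nat \<times> nat \<times> nat \<times> nat) set" where
  "Q_index d = {(i, j, N, k). i \<le> 1 \<and> j \<le> 1 \<and> k \<le> N \<and> i + j + 2 * N = d}"

lemma b_const_square:
  assumes "\<alpha> > -1" "\<beta> > -1"
  shows "(b_const \<alpha> \<beta> i j)\<^sup>2 * a_const \<alpha> \<beta> (-1/2) = a_const (\<alpha> + real i) (\<beta> + real j) (-1/2)"
proof -
  have "a_const (\<alpha> + real i) (\<beta> + real j) (-1/2) = (jacobi_c (\<alpha> + real i) (\<beta> + real j))\<^sup>2"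
    using assms by (intro a_const_eq) auto
  then show ?thesis
    unfolding b_const_def using a_const_eq[OF assms] jacobi_c_pos[OF assms] by simp
qed

lemma rotated_weight_shift:
  "rotated_weight (\<alpha> + real i) (\<beta> + real j) z =
     ((fst z - snd z) ^ i)\<^sup>2 * ((fst z + snd z) ^ j)\<^sup>2 * rotated_weight \<alpha> \<beta> z"
proof -
  have "\<bar>x\<bar> powr (2 * (a + real n) + 1) = (x ^ n)\<^sup>2 * \<bar>x\<bar> powr (2 * a + 1)" for x a n
  proof (cases "x = 0")
    case False
    have "\<bar>x\<bar> powr (2 * (a + real n) + 1) = \<bar>x\<bar> powr real (2 * n) * \<bar>x\<bar> powr (2 * a + 1)"
      by (simp add: powr_add[symmetric] algebra_simps)
    also have "\<bar>x\<bar> powr real (2 * n) = (x ^ n)\<^sup>2"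
      using False by (subst powr_realpow) (simp_all add: power_mult[symmetric] mult.commute power_even_abs)
    finally show ?thesis .
  qed simp
  then show ?thesis by (simp add: rotated_weight_def case_prod_unfold mult_ac)
qed

text \<open>
  Squares of the prefactors are absorbed into the weight and merely raise its parameters, and the
  constants \<open>b_const\<close> are chosen so that the new weight is normalized.
\<close>

lemma W_weight_shift:
  assumes "\<alpha> > -1" "\<beta> > -1"
  shows "(b_const \<alpha> \<beta> i j)\<^sup>2 * (((fst z - snd z) ^ i)\<^sup>2 * ((fst z + snd z) ^ j)\<^sup>2) * W_weight \<alpha> \<beta> z =
    W_weight (\<alpha> + real i) (\<beta> + real j) z"
  unfolding W_weight_eq rotated_weight_shift b_const_square[OF assms, symmetric]
  by (simp only: mult_ac)

lemma jacobi_Q_in_polys2: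
  assumes "\<alpha> > -1" "\<beta> > -1" "t \<in> Q_index d"
  shows "jacobi_Q \<alpha> \<beta> t \<in> polys2 d"
proof -
  obtain i j N k where t: "t = (i, j, N, k)" "k \<le> N" "i + j + 2 * N = d"
    using assms(3) by (auto simp: Q_index_def)
  have "degree (jacobi_p (\<alpha> + real i) (\<beta> + real j) n) = n" for n
    using assms(1,2) by (intro degree_jacobi_p) auto
  then have "sym_product (jacobi_p (\<alpha> + real i) (\<beta> + real j) N) (jacobi_p (\<alpha> + real i) (\<beta> + real j) k) \<in> polys2 (2 * N)"
    using t(2) by (intro sym_product_in_polys2) auto
  from polys2_mult_linear_power[OF polys2_mult_linear_power[OF this, of 1 j], of "-1" i]
  have "(\<lambda>z. (fst z - snd z) ^ i * ((fst z + snd z) ^ j *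
        sym_product (jacobi_p (\<alpha> + real i) (\<beta> + real j) N) (jacobi_p (\<alpha> + real i) (\<beta> + real j) k) z))
      \<in> polys2 (2 * N + j + i)"
    by simp
  moreover have "2 * N + j + i = d" using t(3) by simp
  ultimately show ?thesis
    unfolding t(1) jacobi_Q_def prod.case by (simp only: polys2_scale)
qed

lemma jacobi_Q_symmetries:
  shows jacobi_Q_swap: "jacobi_Q \<alpha> \<beta> (i, j, N, k) (prod.swap z) = (-1) ^ i * jacobi_Q \<alpha> \<beta> (i, j, N, k) z"
    and jacobi_Q_uminus: "jacobi_Q \<alpha> \<beta> (i, j, N, k) (- z) = (-1) ^ (i + j) * jacobi_Q \<alpha> \<beta> (i, j, N, k) z"
proof -
  obtain x y where z: "z = (x, y)" by (cases z)
  have "(y - x) ^ i = (-1) ^ i * (x - y) ^ i"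
    by (simp add: power_mult_distrib[symmetric])
  then show "jacobi_Q \<alpha> \<beta> (i, j, N, k) (prod.swap z) = (-1) ^ i * jacobi_Q \<alpha> \<beta> (i, j, N, k) z"
    by (simp add: jacobi_Q_def z sym_product_swap[of _ _ y x] add.commute[of y x] mult_ac)
  have "(- x + y) ^ i = (-1) ^ i * (x - y) ^ i" "(- x - y) ^ j = (-1) ^ j * (x + y) ^ j"
    by (simp_all add: power_mult_distrib[symmetric])
  then show "jacobi_Q \<alpha> \<beta> (i, j, N, k) (- z) = (-1) ^ (i + j) * jacobi_Q \<alpha> \<beta> (i, j, N, k) z"
    using sym_product_uminus[of _ _ "(x, y)"]
    by (simp add: jacobi_Q_def z power_add mult_ac)
qed

text \<open>
  After the prefactors have been absorbed, the inner product is one of symmetrized products, whose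
  value is a sum of two products of Kronecker deltas. With \<open>k \<le> N\<close> and \<open>l \<le> M\<close> both products are
  nonzero exactly when all four degrees coincide; the two factors \<open>1 / sqrt 2\<close> compensate this.
\<close>

lemma inner_w_jacobi_Q_same_type:
  assumes ab: "\<alpha> > -1" "\<beta> > -1" and "k \<le> N" "l \<le> M"
  shows "inner_w (W_weight \<alpha> \<beta>) (jacobi_Q \<alpha> \<beta> (i, j, N, k)) (jacobi_Q \<alpha> \<beta> (i, j, M, l)) =
    (if N = M \<and> k = l then 1 else 0)"
proof -
  define P where "P = jacobi_p (\<alpha> + real i) (\<beta> + real j)"
  define c where "c N k = (if k = N then 1 / sqrt 2 else 1 :: real)" for N k :: nat
  have ab': "\<alpha> + real i > -1" "\<beta> + real j > -1" using ab by auto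
  have P: "jacobi_functional (\<alpha> + real i) (\<beta> + real j) (P n * P m) = (if n = m then 1 else 0)" for n m
    unfolding P_def by (rule jacobi_functional_jacobi_p[OF ab'])
  have "jacobi_Q \<alpha> \<beta> (i, j, N, k) z * jacobi_Q \<alpha> \<beta> (i, j, M, l) z * W_weight \<alpha> \<beta> z =
     (1 / 2 * c N k * c M l) * (sym_product (P N) (P k) z * sym_product (P M) (P l) z *
        W_weight (\<alpha> + real i) (\<beta> + real j) z)" for z
  proof -
    have half: "1 / sqrt 2 * (1 / sqrt 2) = (1 / 2 :: real)" by simp
    have "jacobi_Q \<alpha> \<beta> (i, j, N, k) z * jacobi_Q \<alpha> \<beta> (i, j, M, l) z * W_weight \<alpha> \<beta> z =
       (1 / sqrt 2 * (1 / sqrt 2)) * c N k * c M l * (sym_product (P N) (P k) z * sym_product (P M) (P l) z *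
        ((b_const \<alpha> \<beta> i j)\<^sup>2 * (((fst z - snd z) ^ i)\<^sup>2 * ((fst z + snd z) ^ j)\<^sup>2) * W_weight \<alpha> \<beta> z))"
      unfolding jacobi_Q_def prod.case P_def c_def power2_eq_square divide_inverse
      by (simp only: mult_ac mult_1_left)
    then show ?thesis unfolding W_weight_shift[OF ab] half .
  qed
  then have "inner_w (W_weight \<alpha> \<beta>) (jacobi_Q \<alpha> \<beta> (i, j, N, k)) (jacobi_Q \<alpha> \<beta> (i, j, M, l)) =
      (1 / 2 * c N k * c M l) * inner_w (W_weight (\<alpha> + real i) (\<beta> + real j))
         (sym_product (P N) (P k)) (sym_product (P M) (P l))"
    unfolding inner_w_def by (simp only: set_integral_mult_right)
  also have "\<dots> = c N k * c M l * ((if N = M then 1 else 0) * (if k = l then 1 else 0) +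
      (if N = l then 1 else 0) * (if k = M then 1 else 0))"
    unfolding inner_w_sym_product[OF ab'] P by simp
  also have "\<dots> = (if N = M \<and> k = l then 1 else 0)"
    using assms(3,4) by (auto simp: c_def)
  finally show ?thesis .
qed

text \<open>
  Members of different families differ in parity under the reflection \<open>(x, y) \<mapsto> (y, x)\<close>, governed by
  \<open>i\<close>, or under \<open>(x, y) \<mapsto> (-x, -y)\<close>, governed by \<open>i + j\<close>; both leave the weight invariant, so their
  inner product vanishes.
\<close>

lemma inner_w_jacobi_Q:
  assumes ab: "\<alpha> > -1" "\<beta> > -1" and t: "t \<in> Q_index d" "t' \<in> Q_index d'"
  shows "inner_w (W_weight \<alpha> \<beta>) (jacobi_Q \<alpha> \<beta> t) (jacobi_Q \<alpha> \<beta> t') = (if t = t' then 1 else 0)"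
proof -
  obtain i j N k where t1: "t = (i, j, N, k)" "i \<le> 1" "j \<le> 1" "k \<le> N"
    using t(1) by (auto simp: Q_index_def)
  obtain i' j' M l where t2: "t' = (i', j', M, l)" "i' \<le> 1" "j' \<le> 1" "l \<le> M"
    using t(2) by (auto simp: Q_index_def)
  show ?thesis
  proof (cases "i = i' \<and> j = j'")
    case True
    then show ?thesis using inner_w_jacobi_Q_same_type[OF ab t1(4) t2(4), of i j]
      by (auto simp: t1 t2)
  next
    case False
    have "odd (i + i') \<or> odd (i + j + (i' + j'))"
      using False t1(2,3) t2(2,3) by (auto simp: le_Suc_eq)
    then have "inner_w (W_weight \<alpha> \<beta>) (jacobi_Q \<alpha> \<beta> t) (jacobi_Q \<alpha> \<beta> t') = 0"
    proof (intro inner_w_odd_eq_0, goal_cases)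
      case 1
      show ?case by (rule polys2_measurable[OF jacobi_Q_in_polys2[OF ab t(1)]])
    next
      case 2
      show ?case by (rule polys2_measurable[OF jacobi_Q_in_polys2[OF ab t(2)]])
    next
      case 3
      have *: "(-1) ^ m * a * ((-1) ^ n * b) = - (a * b)" if "odd (m + n)" for m n and a b :: real
      proof -
        have "(-1) ^ m * a * ((-1) ^ n * b) = (-1) ^ (m + n) * (a * b)" by (simp only: power_add mult_ac)
        also have "(-1) ^ (m + n) = (-1 :: real)" using that by (rule neg_one_odd_power)
        finally show ?thesis by simp
      qed
      from 3 show ?case
        unfolding t1 t2 jacobi_Q_symmetries using * by blast
    qed
    then show ?thesis using False by (auto simp: t1 t2)
  qed
qed

section \<open>Completeness\<close>

lemma Q_index_even: "Q_index (2 * n) = (\<lambda>k. (0, 0, n, k)) ` {..n} \<union> (\<lambda>k. (1, 1, n - 1, k)) ` {..<n}"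
proof (intro equalityI subsetI)
  fix t assume "t \<in> Q_index (2 * n)"
  then obtain i j N k where t: "t = (i, j, N, k)" "i \<le> 1" "j \<le> 1" "k \<le> N" "i + j + 2 * N = 2 * n"
    by (auto simp: Q_index_def)
  then have "(i = 0 \<and> j = 0 \<and> N = n) \<or> (i = 1 \<and> j = 1 \<and> n = Suc N)" by presburger
  then show "t \<in> (\<lambda>k. (0, 0, n, k)) ` {..n} \<union> (\<lambda>k. (1, 1, n - 1, k)) ` {..<n}"
    using t by auto
qed (auto simp: Q_index_def)

lemma Q_index_odd: "Q_index (2 * n + 1) = (\<lambda>k. (0, 1, n, k)) ` {..n} \<union> (\<lambda>k. (1, 0, n, k)) ` {..n}"
proof (intro equalityI subsetI)
  fix t assume "t \<in> Q_index (2 * n + 1)"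
  then obtain i j N k where t: "t = (i, j, N, k)" "i \<le> 1" "j \<le> 1" "k \<le> N" "i + j + 2 * N = 2 * n + 1"
    by (auto simp: Q_index_def)
  then have "(i = 0 \<and> j = 1 \<and> N = n) \<or> (i = 1 \<and> j = 0 \<and> N = n)" by presburger
  then show "t \<in> (\<lambda>k. (0, 1, n, k)) ` {..n} \<union> (\<lambda>k. (1, 0, n, k)) ` {..n}"
    using t by auto
qed (auto simp: Q_index_def)

lemma finite_card_Q_index: "finite (Q_index d) \<and> card (Q_index d) = d + 1"
proof (cases "even d")
  case True
  then obtain n where d: "d = 2 * n" by blast
  have "card (Q_index d) = card ((\<lambda>k. (0::nat, 0::nat, n, k)) ` {..n}) + card ((\<lambda>k. (1::nat, 1::nat, n - 1, k)) ` {..<n})"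
    unfolding d Q_index_even by (rule card_Un_disjoint) auto
  also have "\<dots> = d + 1"
    by (simp add: card_image inj_on_def d)
  finally show ?thesis by (simp add: d Q_index_even)
next
  case False
  then obtain n where d: "d = 2 * n + 1" by (blast elim: oddE)
  have "card (Q_index d) = card ((\<lambda>k. (0::nat, 1::nat, n, k)) ` {..n}) + card ((\<lambda>k. (1::nat, 0::nat, n, k)) ` {..n})"
    unfolding d Q_index_odd by (rule card_Un_disjoint) auto
  also have "\<dots> = d + 1"
    by (simp add: card_image inj_on_def d)
  finally show ?thesis unfolding d Q_index_odd by simp
qed

lemma disjoint_Q_index: "d \<noteq> e \<Longrightarrow> Q_index d \<inter> Q_index e = {}"
  by (auto simp: Q_index_def)

text \<open>
  Degree \<open>e\<close> contributes \<open>e + 1\<close> orthonormal functions, as many as there are monomials of that degree.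
  The coefficients are recovered by the inner product, which serves as the dual family.
\<close>

lemma jacobi_Q_spans:
  assumes ab: "\<alpha> > -1" "\<beta> > -1" and f: "f \<in> polys2 d"
  shows "\<exists>c. f = (\<lambda>z. \<Sum>t\<in>(\<Union>e\<le>d. Q_index e). c t * jacobi_Q \<alpha> \<beta> t z)"
proof (rule dual_family_spans[where B = "monomials d"
      and \<phi> = "\<lambda>t f. inner_w (W_weight \<alpha> \<beta>) f (jacobi_Q \<alpha> \<beta> t)"])
  let ?J = "\<Union>e\<le>d. Q_index e"
  show fin: "finite ?J" using finite_card_Q_index by blast
  show "finite (monomials d)" by (rule finite_monomials)
  have "card ?J = (\<Sum>e\<le>d. card (Q_index e))"
    using finite_card_Q_index disjoint_Q_index by (intro card_UN_disjoint) auto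
  then show "card (monomials d) \<le> card ?J"
    using card_monomials_le[of d] finite_card_Q_index by simp
  have Q: "jacobi_Q \<alpha> \<beta> t \<in> polys2 d" if "t \<in> ?J" for t
    using that jacobi_Q_in_polys2[OF ab] polys2_mono by blast
  then show "jacobi_Q \<alpha> \<beta> t \<in> fun_space.span (monomials d)" if "t \<in> ?J" for t
    using that by (simp add: polys2_eq_span)
  show "f \<in> fun_space.span (monomials d)" using f by (simp add: polys2_eq_span)
  fix c t assume t: "t \<in> ?J"
  have "inner_w (W_weight \<alpha> \<beta>) (\<lambda>z. \<Sum>i\<in>?J. c i * jacobi_Q \<alpha> \<beta> i z) (jacobi_Q \<alpha> \<beta> t) =
      (\<Sum>i\<in>?J. c i * inner_w (W_weight \<alpha> \<beta>) (jacobi_Q \<alpha> \<beta> i) (jacobi_Q \<alpha> \<beta> t))"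
    by (rule inner_w_sum_left[OF ab Q Q[OF t]])
  also have "\<dots> = (\<Sum>i\<in>?J. if i = t then c i else 0)"
  proof (intro sum.cong refl)
    fix i assume "i \<in> ?J"
    then have "inner_w (W_weight \<alpha> \<beta>) (jacobi_Q \<alpha> \<beta> i) (jacobi_Q \<alpha> \<beta> t) = (if i = t then 1 else 0)"
      using t inner_w_jacobi_Q[OF ab] by blast
    then show "c i * inner_w (W_weight \<alpha> \<beta>) (jacobi_Q \<alpha> \<beta> i) (jacobi_Q \<alpha> \<beta> t) = (if i = t then c i else 0)"
      by simp
  qed
  also have "\<dots> = c t" using fin t by simp
  finally show "inner_w (W_weight \<alpha> \<beta>) (\<lambda>z. \<Sum>i\<in>?J. c i * jacobi_Q \<alpha> \<beta> i z) (jacobi_Q \<alpha> \<beta> t) = c t" .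
qed

text \<open>
  Polynomials of lower degree are combinations of members of lower degree, which gives the
  orthogonality required of \<open>V_space\<close>. Conversely, a member of \<open>V_space\<close> is a combination of members of
  degree at most \<open>d\<close>, and orthogonality to those of degree \<open>e < d\<close> removes their coefficients.
\<close>

theorem jacobi_Q_orthonormal_basis:
  assumes ab: "\<alpha> > -1" "\<beta> > -1"
  shows "is_orthonormal_basis (W_weight \<alpha> \<beta>) (V_space (W_weight \<alpha> \<beta>) d) (Q_index d) (jacobi_Q \<alpha> \<beta>)"
proof -
  let ?W = "W_weight \<alpha> \<beta>" and ?Q = "jacobi_Q \<alpha> \<beta>"
  let ?J = "\<lambda>d. \<Union>e\<le>d. Q_index e"
  have Q: "?Q t \<in> polys2 d" if "t \<in> ?J d" for t d
    using that jacobi_Q_in_polys2[OF ab] polys2_mono by blast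
  have fin: "finite (?J d)" for d using finite_card_Q_index by blast
  have inner: "inner_w ?W (\<lambda>z. \<Sum>i\<in>?J d. c i * ?Q i z) (?Q t) = (if t \<in> ?J d then c t else 0)"
    if "t \<in> Q_index e" for c t d e
  proof -
    have "inner_w ?W (\<lambda>z. \<Sum>i\<in>?J d. c i * ?Q i z) (?Q t) = (\<Sum>i\<in>?J d. c i * inner_w ?W (?Q i) (?Q t))"
      by (rule inner_w_sum_left[OF ab Q jacobi_Q_in_polys2[OF ab that]])
    also have "\<dots> = (\<Sum>i\<in>?J d. if i = t then c i else 0)"
    proof (intro sum.cong refl)
      fix i assume "i \<in> ?J d"
      then have "inner_w ?W (?Q i) (?Q t) = (if i = t then 1 else 0)"
        using that inner_w_jacobi_Q[OF ab] by blast
      then show "c i * inner_w ?W (?Q i) (?Q t) = (if i = t then c i else 0)" by simp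
    qed
    finally show ?thesis using fin by simp
  qed
  have V: "?Q t \<in> V_space ?W d" if t: "t \<in> Q_index d" for t
    unfolding V_space_def
  proof (intro CollectI conjI allI impI ballI)
    show "?Q t \<in> polys2 d" by (rule jacobi_Q_in_polys2[OF ab t])
    fix e g assume "e < d" "g \<in> polys2 e"
    with jacobi_Q_spans[OF ab] obtain c where g: "g = (\<lambda>z. \<Sum>i\<in>?J e. c i * ?Q i z)" by blast
    have "t \<notin> ?J e" using t \<open>e < d\<close> by (auto simp: Q_index_def)
    then show "inner_w ?W (?Q t) g = 0"
      by (subst inner_w_commute) (simp add: g inner[OF t])
  qed
  have span: "\<exists>c. f = (\<lambda>z. \<Sum>i\<in>Q_index d. c i * ?Q i z)" if f: "f \<in> V_space ?W d" for f
  proof -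
    have "f \<in> polys2 d" using f by (simp add: V_space_def)
    then obtain c where c: "f = (\<lambda>z. \<Sum>i\<in>?J d. c i * ?Q i z)"
      using jacobi_Q_spans[OF ab] by blast
    have "c t = 0" if t: "t \<in> ?J d - Q_index d" for t
    proof -
      obtain e where e: "e < d" "t \<in> Q_index e"
        using t by (auto simp: le_less)
      then have "inner_w ?W f (?Q t) = 0"
        using f jacobi_Q_in_polys2[OF ab e(2)] by (simp add: V_space_def)
      then show ?thesis using inner[OF e(2), where d = d and c = c] t by (simp add: c)
    qed
    then have "(\<Sum>i\<in>?J d. c i * ?Q i z) = (\<Sum>i\<in>Q_index d. c i * ?Q i z)" for z
      using fin by (intro sum.mono_neutral_right) auto
    then show ?thesis unfolding c by auto
  qed
  show ?thesis
    unfolding is_orthonormal_basis_def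
  proof (intro conjI ballI)
    show "finite (Q_index d)" using finite_card_Q_index by blast
  qed (fact V inner_w_jacobi_Q[OF ab] span)+
qed

lemma is_orthonormal_basis_reindex:
  assumes "is_orthonormal_basis w V I Q" and g: "bij_betw g K I"
  shows "is_orthonormal_basis w V K (\<lambda>k. Q (g k))"
  unfolding is_orthonormal_basis_def
proof (intro conjI ballI)
  note * = assms(1)[unfolded is_orthonormal_basis_def]
  have gI: "g k \<in> I" if "k \<in> K" for k using g that by (auto simp: bij_betw_def)
  show "finite K" using * g by (simp add: bij_betw_finite)
  show "Q (g k) \<in> V" if "k \<in> K" for k using * gI[OF that] by blast
  show "inner_w w (Q (g i)) (Q (g j)) = (if i = j then 1 else 0)" if "i \<in> K" "j \<in> K" for i j
    using * gI[OF that(1)] gI[OF that(2)] that g by (auto simp: bij_betw_def inj_on_def)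
  fix f assume "f \<in> V"
  then obtain c where f: "f = (\<lambda>z. \<Sum>i\<in>I. c i * Q i z)" using * by blast
  have "f = (\<lambda>z. \<Sum>k\<in>K. c (g k) * Q (g k) z)"
    unfolding f
    by (rule ext) (rule sum.reindex_bij_betw[OF g, symmetric])
  then show "\<exists>c. f = (\<lambda>z. \<Sum>k\<in>K. c k * Q (g k) z)" by (rule exI[where x="\<lambda>k. c (g k)"])
qed

lemma jacobi_Q_cos:
  "jacobi_Q \<alpha> \<beta> (i, j, N, k) (cos \<theta>, cos \<phi>) =
     b_const \<alpha> \<beta> i j / sqrt 2 * ((cos \<theta> - cos \<phi>) ^ i * (cos \<theta> + cos \<phi>) ^ j) *
     jacobi_sym (\<alpha> + real i) (\<beta> + real j) N k \<theta> \<phi>"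
  by (simp add: jacobi_Q_def jacobi_sym_def sym_product_cos mult_ac)

lemma b_const_0_0: "\<alpha> > -1 \<Longrightarrow> \<beta> > -1 \<Longrightarrow> b_const \<alpha> \<beta> 0 0 = 1"
  using jacobi_c_pos[of \<alpha> \<beta>] a_const_eq[of \<alpha> \<beta>] unfolding b_const_def by simp

theorem proposition4p6:
  fixes \<alpha> \<beta> :: real and n :: nat
  assumes "\<alpha> > -1" and "\<beta> > -1"
  shows
    "(\<exists>Q :: nat \<times> nat \<Rightarrow> real \<times> real \<Rightarrow> real.
        (\<forall>k\<le>n. \<forall>\<theta>\<in>{0..pi}. \<forall>\<phi>\<in>{0..pi}.
           Q (1, k) (cos \<theta>, cos \<phi>) = 1 / sqrt 2 * jacobi_sym \<alpha> \<beta> n k \<theta> \<phi>) \<and>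
        (\<forall>k<n. \<forall>\<theta>\<in>{0..pi}. \<forall>\<phi>\<in>{0..pi}.
           Q (2, k) (cos \<theta>, cos \<phi>) =
             b_const \<alpha> \<beta> 1 1 / sqrt 2 * ((cos \<theta>)\<^sup>2 - (cos \<phi>)\<^sup>2) *
             jacobi_sym (\<alpha> + 1) (\<beta> + 1) (n - 1) k \<theta> \<phi>) \<and>
        is_orthonormal_basis (W_weight \<alpha> \<beta>) (V_space (W_weight \<alpha> \<beta>) (2 * n))
          ({1} \<times> {..n} \<union> {2} \<times> {..<n}) Q) \<and>
     (\<exists>Q :: nat \<times> nat \<Rightarrow> real \<times> real \<Rightarrow> real.
        (\<forall>k\<le>n. \<forall>\<theta>\<in>{0..pi}. \<forall>\<phi>\<in>{0..pi}.
           Q (1, k) (cos \<theta>, cos \<phi>) =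
             b_const \<alpha> \<beta> 0 1 / sqrt 2 * (cos \<theta> + cos \<phi>) *
             jacobi_sym \<alpha> (\<beta> + 1) n k \<theta> \<phi>) \<and>
        (\<forall>k\<le>n. \<forall>\<theta>\<in>{0..pi}. \<forall>\<phi>\<in>{0..pi}.
           Q (2, k) (cos \<theta>, cos \<phi>) =
             b_const \<alpha> \<beta> 1 0 / sqrt 2 * (cos \<theta> - cos \<phi>) *
             jacobi_sym (\<alpha> + 1) \<beta> n k \<theta> \<phi>) \<and>
        is_orthonormal_basis (W_weight \<alpha> \<beta>) (V_space (W_weight \<alpha> \<beta>) (2 * n + 1))
          ({1, 2} \<times> {..n}) Q)"
proof (intro conjI)
  note basis = jacobi_Q_orthonormal_basis[OF assms]
  \<comment> \<open>the truncated \<open>n - 1\<close> is harmless: for \<open>n = 0\<close> the second family is empty\<close>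
  define g :: "nat \<times> nat \<Rightarrow> nat \<times> nat \<times> nat \<times> nat" where
    "g = (\<lambda>(t, k). if t = 1 then (0, 0, n, k) else (1, 1, n - 1, k))"
  have "bij_betw g ({1} \<times> {..n} \<union> {2} \<times> {..<n}) (Q_index (2 * n))"
    unfolding bij_betw_def
  proof
    show "inj_on g ({1} \<times> {..n} \<union> {2} \<times> {..<n})" by (auto simp: inj_on_def g_def)
    show "g ` ({1} \<times> {..n} \<union> {2} \<times> {..<n}) = Q_index (2 * n)"
    proof -
      have "g ` ({1} \<times> {..n}) = (\<lambda>k. (0, 0, n, k)) ` {..n}"
        and "g ` ({2} \<times> {..<n}) = (\<lambda>k. (1, 1, n - 1, k)) ` {..<n}"
        by (auto simp: g_def image_def)
      then show ?thesis by (simp only: Q_index_even image_Un)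
    qed
  qed
  note basis_even = is_orthonormal_basis_reindex[OF basis this]
  show "\<exists>Q :: nat \<times> nat \<Rightarrow> real \<times> real \<Rightarrow> real.
        (\<forall>k\<le>n. \<forall>\<theta>\<in>{0..pi}. \<forall>\<phi>\<in>{0..pi}.
           Q (1, k) (cos \<theta>, cos \<phi>) = 1 / sqrt 2 * jacobi_sym \<alpha> \<beta> n k \<theta> \<phi>) \<and>
        (\<forall>k<n. \<forall>\<theta>\<in>{0..pi}. \<forall>\<phi>\<in>{0..pi}.
           Q (2, k) (cos \<theta>, cos \<phi>) =
             b_const \<alpha> \<beta> 1 1 / sqrt 2 * ((cos \<theta>)\<^sup>2 - (cos \<phi>)\<^sup>2) *
             jacobi_sym (\<alpha> + 1) (\<beta> + 1) (n - 1) k \<theta> \<phi>) \<and>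
        is_orthonormal_basis (W_weight \<alpha> \<beta>) (V_space (W_weight \<alpha> \<beta>) (2 * n))
          ({1} \<times> {..n} \<union> {2} \<times> {..<n}) Q"
    by (rule exI[where x="\<lambda>t. jacobi_Q \<alpha> \<beta> (g t)"], intro conjI allI impI ballI basis_even)
       (simp_all add: g_def jacobi_Q_cos b_const_0_0[OF assms] power2_eq_square algebra_simps)
next
  note basis = jacobi_Q_orthonormal_basis[OF assms]
  define g :: "nat \<times> nat \<Rightarrow> nat \<times> nat \<times> nat \<times> nat" where
    "g = (\<lambda>(t, k). if t = 1 then (0, 1, n, k) else (1, 0, n, k))"
  have "bij_betw g ({1, 2} \<times> {..n}) (Q_index (2 * n + 1))"
    unfolding bij_betw_def
  proof
    show "inj_on g ({1, 2} \<times> {..n})" by (auto simp: inj_on_def g_def)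
    show "g ` ({1, 2} \<times> {..n}) = Q_index (2 * n + 1)"
    proof -
      have "g ` ({1} \<times> {..n}) = (\<lambda>k. (0, 1, n, k)) ` {..n}"
        and "g ` ({2} \<times> {..n}) = (\<lambda>k. (1, 0, n, k)) ` {..n}"
        by (auto simp: g_def image_def)
      moreover have "{1, 2} \<times> {..n} = {1} \<times> {..n} \<union> {2 :: nat} \<times> {..n}" by blast
      ultimately show ?thesis by (simp only: Q_index_odd image_Un)
    qed
  qed
  note basis_odd = is_orthonormal_basis_reindex[OF basis this]
  show "\<exists>Q :: nat \<times> nat \<Rightarrow> real \<times> real \<Rightarrow> real.
        (\<forall>k\<le>n. \<forall>\<theta>\<in>{0..pi}. \<forall>\<phi>\<in>{0..pi}.
           Q (1, k) (cos \<theta>, cos \<phi>) =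
             b_const \<alpha> \<beta> 0 1 / sqrt 2 * (cos \<theta> + cos \<phi>) *
             jacobi_sym \<alpha> (\<beta> + 1) n k \<theta> \<phi>) \<and>
        (\<forall>k\<le>n. \<forall>\<theta>\<in>{0..pi}. \<forall>\<phi>\<in>{0..pi}.
           Q (2, k) (cos \<theta>, cos \<phi>) =
             b_const \<alpha> \<beta> 1 0 / sqrt 2 * (cos \<theta> - cos \<phi>) *
             jacobi_sym (\<alpha> + 1) \<beta> n k \<theta> \<phi>) \<and>
        is_orthonormal_basis (W_weight \<alpha> \<beta>) (V_space (W_weight \<alpha> \<beta>) (2 * n + 1))
          ({1, 2} \<times> {..n}) Q"
    by (rule exI[where x="\<lambda>t. jacobi_Q \<alpha> \<beta> (g t)"], intro conjI allI impI ballI basis_odd)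
       (simp_all add: g_def jacobi_Q_cos)
qed

end
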